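(* Let $p$ satisfy (H$_p$) and let $\varrho_0\in L^\infty(\mathbb{T}^d)$, $\varrho_0\ge0$. For every $T>0$ there exists a unique solution $(\eta,\sigma)\in L^\infty([0,T]\times\mathbb{T}^d)\times L^\infty([0,T]\times\mathbb{T}^d)$ of the Lagrangian system (L) with $\eta(0,y)=\varrho_0(y)$. Moreover, there is a constant $r$, independent of $T$, such that $\|\eta\|_{L^\infty([0,T]\times\mathbb{T}^d)}\le r$.
   Context: Assumption (H$_p$): $p:[0,\infty)\to\mathbb{R}$ is $C^1$, unbounded above, and there are constants $C>0$, $C_1,C_2\in\mathbb{R}$, $\bar\varrho>0$ with $-C\le p(\varrho)\le CP(\varrho)$ for all $\varrho\ge0$, where $P(\varrho):=\varrho\int_{\bar\varrho}^{\varrho}\frac{p(s)}{s^2}\,ds + C_1\varrho + C_2\ge 0$. The Lagrangian system (L) for unknowns $\eta,\sigma:[0,T]\times\mathbb{T}^d\to\mathbb{R}$ is \[ \partial_t\eta+\eta\sigma=0,\qquad \sigma=p(\eta)-\{p(\eta)\}_\sigma, \] understood as $\eta(t,y)=\varrho_0(y)-\int_0^t\eta(s,y)\sigma(s,y)\,ds$ and $\sigma(t,y)=p(\eta(t,y))-\{p(\eta)\}_\sigma(t)$ for a.e. $(t,y)$, where for a function $f(t,y)$ \[ \{f\}_\sigma(t)=\frac{1}{|\mathbb{T}^d|}\int_{\mathbb{T}^d}f(t,y)\exp\Big(\int_0^t\sigma(s,y)\,ds\Big)\,dy. \] *)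

theory Defs
  imports "HOL-Analysis.Analysis"
begin

text \<open>The flat torus is modelled by the unit cube [0,1]^d (the system (L) involves
  no derivatives in y, so only the measure space structure of the torus matters).\<close>
definition torus :: "(real^'d) set" where
  "torus = cbox 0 One"

definition Linfty_on :: "'a::euclidean_space set \<Rightarrow> ('a \<Rightarrow> real) \<Rightarrow> bool" where
  "Linfty_on S f \<longleftrightarrow> set_borel_measurable lebesgue S f \<and>
     (\<exists>B. AE x in lebesgue. x \<in> S \<longrightarrow> \<bar>f x\<bar> \<le> B)"

definition avg_sigma :: "(real \<Rightarrow> real^'d \<Rightarrow> real) \<Rightarrow> (real \<Rightarrow> real^'d \<Rightarrow> real) \<Rightarrow> real \<Rightarrow> real" where
  "avg_sigma \<sigma> f t = (1 / measure lebesgue (torus :: (real^'d) set)) *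
     (LINT y:torus|lebesgue. f t y * exp (LINT s:{0..t}|lebesgue. \<sigma> s y))"

definition Pfun :: "(real \<Rightarrow> real) \<Rightarrow> real \<Rightarrow> real \<Rightarrow> real \<Rightarrow> real \<Rightarrow> real" where
  "Pfun p rhobar C1 C2 x =
     x * interval_lebesgue_integral lborel (ereal rhobar) (ereal x) (\<lambda>s. p s / s^2) + C1 * x + C2"

text \<open>Assumption (H_p). C^1 on [0,\<infinity>) is one-sided at 0. The inequalities involving P are
  required for x > 0 (at x = 0 they follow by continuity, P(0) being defined as a limit).\<close>
definition Hp :: "(real \<Rightarrow> real) \<Rightarrow> bool" where
  "Hp p \<longleftrightarrow>
     (\<exists>D. (\<forall>x\<ge>0. (p has_real_derivative D x) (at x within {0..})) \<and> continuous_on {0..} D) \<and>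
     (\<forall>M. \<exists>x\<ge>0. p x > M) \<and>
     (\<exists>C>0. \<exists>C1 C2. \<exists>rhobar>0.
        (\<forall>x\<ge>0. - C \<le> p x) \<and>
        (\<forall>x>0. p x \<le> C * Pfun p rhobar C1 C2 x \<and> 0 \<le> Pfun p rhobar C1 C2 x))"

definition solves_L :: "(real \<Rightarrow> real) \<Rightarrow> (real^'d \<Rightarrow> real) \<Rightarrow> real \<Rightarrow>
    (real \<Rightarrow> real^'d \<Rightarrow> real) \<Rightarrow> (real \<Rightarrow> real^'d \<Rightarrow> real) \<Rightarrow> bool" where
  "solves_L p rho0 T \<eta> \<sigma> \<longleftrightarrow>
     Linfty_on ({0..T} \<times> torus) (\<lambda>(t,y). \<eta> t y) \<and>
     Linfty_on ({0..T} \<times> torus) (\<lambda>(t,y). \<sigma> t y) \<and>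
     (AE z in lebesgue. z \<in> {0..T} \<times> torus \<longrightarrow>
        (\<eta> (fst z) (snd z) = rho0 (snd z) - (LINT s:{0..fst z}|lebesgue. \<eta> s (snd z) * \<sigma> s (snd z)) \<and>
         \<sigma> (fst z) (snd z) = p (\<eta> (fst z) (snd z)) - avg_sigma \<sigma> (\<lambda>t y. p (\<eta> t y)) (fst z)))"

end

theory Submission
  imports Defs "HOL-Probability.Probability_Measure"
begin

text \<open>
  Put u(t,y) for the time integral of \<sigma>(s,y) over [0,t]. Then \<eta> = \<rho> exp(-u), and (L) becomes
  u' = p(\<rho> exp(-u)) - m(t) with m(t) the mean of p(\<rho> exp(-u)) exp(u); in particular u depends on y only
  through the initial density x = \<rho>(y). Hence (L) is an ordinary differential equation in the Banach space of
  bounded continuous functions of x, with a locally Lipschitz right-hand side.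

  Existence is Picard's theorem for the equation truncated at |u| = B, together with an a priori bound:
  the mean of exp(u) stays equal to 1, the energy, i.e. the mean of P(\<eta>) exp(u), decreases, and so
  -C \<le> m \<le> C E(0). If r is at least the maximum of \<rho> and p(r) > C E(0), then \<eta> cannot cross r upwards,
  for any time horizon; this bounds u' and lets one remove the truncation.

  For an arbitrary bounded solution one recovers \<eta> = \<rho> exp(-u) almost everywhere, and two solutions are
  compared in the weighted supremum norm. The bound by r then holds for every solution by uniqueness.
\<close>

section \<open>Picard's theorem and differentiation under the integral\<close>

text \<open>Taking the initial density x as the space variable has two benefits. Evaluating a
  continuous function of x at \<open>\<rho> y\<close> is measurable for free, and the trajectory
  from x = 0 exists even if \<open>\<rho>\<close> never vanishes; it supplies the integrating factor
  for conservation of the mean of exp(u). A given solution, however, is only a pair of measurable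
  functions, not known to depend on y through \<open>\<rho>\<close> alone, and its equations hold
  off a null set. Uniqueness is therefore proved for displacements as functions of y.

  The constants are chosen in the order r, S, B. The level r depends on p, C, E(0) and the bound
  \<open>R0\<close> of \<open>\<rho>\<close>; S bounds the speed of u while the density stays in
  [0,r]; T enters only in B = S T + 1. Truncation makes the vector field globally Lipschitz, and an
  exponential weight in time makes the Picard map contract on all of [0,T], so that no local
  solutions have to be glued.

  Vacuum needs care: P tends to C2 - p(0) at 0, and this value is exactly what the identity x P' - P
  = p - C2 demands there.\<close>

lemma has_integral_exp_double_rate:
  fixes L t :: real
  assumes "0 \<le> t"
  shows "((\<lambda>s. L * exp (2 * L * s)) has_integral (exp (2 * L * t) - 1) / 2) {0..t}"
proof -
  have "((\<lambda>s. L * exp (2 * L * s)) has_integral (exp (2 * L * t) / 2 - exp (2 * L * 0) / 2)) {0..t}"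
    by (rule fundamental_theorem_of_calculus[OF assms])
       (auto intro!: derivative_eq_intros simp flip: has_real_derivative_iff_has_vector_derivative)
  then show ?thesis by (simp add: diff_divide_distrib)
qed

instance bcontfun :: (metric_space, banach) banach ..

text \<open>Writing u(t) = exp(2Lt) v(t) amounts to using a weighted supremum norm. The Lipschitz
  estimate integrates to at most exp(2Lt)/2 times the distance, and the weight cancels the
  exponential, so the Picard map contracts by 1/2 whatever the length of [0,T].\<close>

lemma picard_global:
  fixes F :: "'b::banach \<Rightarrow> 'b"
  assumes L: "0 < L" and lip: "\<And>x y. norm (F x - F y) \<le> L * norm (x - y)"
    and T: "0 \<le> T"
  obtains u where "continuous_on {0..T} u" "u 0 = 0"
    "\<And>t. t \<in> {0..T} \<Longrightarrow> (u has_vector_derivative F (u t)) (at t within {0..T})"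
proof -
  \<comment> \<open>Elements of the space of bounded continuous functions live on the whole line;
    clamping time extends the image of the Picard map constantly outside [0,T] and keeps it
    bounded.\<close>
  define cl where "cl t = max 0 (min T t)" for t :: real
  have cl: "cl t \<in> {0..T}" "0 \<le> cl t" "t \<in> {0..T} \<Longrightarrow> cl t = t" for t
    using T by (auto simp: cl_def)
  have clc: "continuous_on S cl" for S by (auto simp: cl_def intro!: continuous_intros)
  have Fc: "continuous_on S F" for S
    using L lip by (intro lipschitz_on_continuous_on[of L] lipschitz_onI) (auto simp: dist_norm)
  define h where "h v s = F (exp (2 * L * s) *\<^sub>R apply_bcontfun v s)" for v :: "real \<Rightarrow>\<^sub>C 'b" and s
  have hc: "continuous_on S (h v)" for v S
    unfolding h_def by (intro continuous_on_compose2[OF Fc[of UNIV]] continuous_intros) auto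
  have hi: "h v integrable_on {0..t}" for v t
    by (rule integrable_continuous_real[OF hc])
  define H where "H v t = exp (- 2 * L * cl t) *\<^sub>R integral {0..cl t} (h v)" for v t
  have Ic: "continuous_on {0..T} (\<lambda>t. integral {0..t} (h v))" for v
    by (rule indefinite_integral_continuous_1[OF hi])
  have Hc: "continuous_on UNIV (H v)" for v
    unfolding H_def using cl
    by (intro continuous_intros clc continuous_on_compose2[OF Ic clc]) auto
  have Hb: "H v \<in> bcontfun" for v
  proof -
    have "compact ((\<lambda>t. exp (- 2 * L * t) *\<^sub>R integral {0..t} (h v)) ` {0..T})"
      by (intro compact_continuous_image continuous_intros Ic) auto
    then have "bounded ((\<lambda>t. exp (- 2 * L * t) *\<^sub>R integral {0..t} (h v)) ` {0..T})"
      by (rule compact_imp_bounded)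
    moreover have "range (H v) \<subseteq> ((\<lambda>t. exp (- 2 * L * t) *\<^sub>R integral {0..t} (h v)) ` {0..T})"
      using cl unfolding H_def by blast
    ultimately show ?thesis using Hc bounded_subset unfolding bcontfun_def by blast
  qed
  have contr: "dist (Bcontfun (H v)) (Bcontfun (H w)) \<le> (1/2) * dist v w" for v w
  proof (rule dist_bound)
    fix t
    let ?t = "cl t" and ?d = "dist v w"
    have "norm (integral {0..?t} (h v) - integral {0..?t} (h w))
        = norm (integral {0..?t} (\<lambda>s. h v s - h w s))"
      by (simp add: Henstock_Kurzweil_Integration.integral_diff hi)
    also have "\<dots> \<le> integral {0..?t} (\<lambda>s. ?d * (L * exp (2 * L * s)))"
    proof (rule integral_norm_bound_integral)
      show "(\<lambda>s. h v s - h w s) integrable_on {0..?t}" by (intro integrable_diff hi)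
      show "(\<lambda>s. ?d * (L * exp (2 * L * s))) integrable_on {0..?t}"
        by (intro integrable_continuous_real continuous_intros)
      fix s
      have "norm (h v s - h w s) \<le> L * norm (exp (2 * L * s) *\<^sub>R apply_bcontfun v s - exp (2 * L * s) *\<^sub>R apply_bcontfun w s)"
        unfolding h_def by (rule lip)
      also have "\<dots> = L * exp (2 * L * s) * dist (apply_bcontfun v s) (apply_bcontfun w s)"
        by (simp add: dist_norm flip: scaleR_diff_right)
      also have "\<dots> \<le> L * exp (2 * L * s) * ?d"
        using L by (intro mult_left_mono dist_bounded) auto
      finally show "norm (h v s - h w s) \<le> ?d * (L * exp (2 * L * s))" by (simp add: mult_ac)
    qed
    also have "\<dots> = ?d * ((exp (2 * L * ?t) - 1) / 2)"
      using has_integral_mult_right[OF has_integral_exp_double_rate[OF cl(2)], of ?d L t]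
      by (rule integral_unique)
    also have "\<dots> \<le> ?d * (exp (2 * L * ?t) / 2)" by (intro mult_left_mono) auto
    finally have *: "norm (integral {0..?t} (h v) - integral {0..?t} (h w)) \<le> ?d * (exp (2 * L * ?t) / 2)" .
    have "dist (H v t) (H w t) = exp (- 2 * L * ?t) * norm (integral {0..?t} (h v) - integral {0..?t} (h w))"
      unfolding H_def by (simp add: dist_norm flip: scaleR_diff_right)
    also have "\<dots> \<le> exp (- 2 * L * ?t) * (?d * (exp (2 * L * ?t) / 2))"
      by (intro mult_left_mono *) auto
    also have "\<dots> = 1/2 * ?d" by (simp add: exp_minus)
    finally show "dist (apply_bcontfun (Bcontfun (H v)) t) (apply_bcontfun (Bcontfun (H w)) t) \<le> (1/2) * ?d"
      by (simp add: Bcontfun_inverse Hb)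
  qed
  then have "\<exists>!v. Bcontfun (H v) = v" by (intro banach_fix_type[of "1/2"]) simp_all
  then obtain v where v: "Bcontfun (H v) = v" by (elim ex1E)
  have vt: "apply_bcontfun v t = H v t" for t
    by (metis v Bcontfun_inverse Hb)
  define u where "u t = exp (2 * L * t) *\<^sub>R apply_bcontfun v t" for t
  have u: "u t = integral {0..t} (\<lambda>s. F (u s))" if "t \<in> {0..T}" for t
  proof -
    have "h v = (\<lambda>s. F (u s))" by (simp add: h_def u_def fun_eq_iff)
    moreover have "u t = exp (2 * L * t) *\<^sub>R H v t" unfolding u_def by (simp only: vt[of t])
    ultimately show ?thesis using cl(3)[OF that] by (simp add: H_def exp_minus)
  qed
  have uc: "continuous_on S u" for S unfolding u_def by (intro continuous_intros) auto
  have "(u has_vector_derivative F (u t)) (at t within {0..T})" if "t \<in> {0..T}" for t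
  proof (rule has_vector_derivative_transform[OF that u])
    show "((\<lambda>t. integral {0..t} (\<lambda>s. F (u s))) has_vector_derivative F (u t)) (at t within {0..T})"
      by (rule integral_has_vector_derivative[OF _ that])
         (intro continuous_on_compose2[OF Fc[of UNIV] uc], auto)
  qed
  moreover have "u 0 = 0" using u[of 0] T by simp
  ultimately show ?thesis using uc that by blast
qed

text \<open>Dominated convergence along sequences tending to t: by the mean value theorem every
  difference quotient is bounded by the constant \<open>B'\<close>, which is integrable since
  \<open>M\<close> is finite. Derivatives within the interval cover the endpoints as well.\<close>

lemma has_real_derivative_integral_param:
  fixes g g' :: "real \<Rightarrow> 'a \<Rightarrow> real"
  assumes "finite_measure M"
    and meas: "\<And>t. t \<in> {a..b} \<Longrightarrow> g t \<in> borel_measurable M"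
    and bnd: "\<And>t y. t \<in> {a..b} \<Longrightarrow> y \<in> space M \<Longrightarrow> \<bar>g t y\<bar> \<le> B"
    and meas': "\<And>t. t \<in> {a..b} \<Longrightarrow> g' t \<in> borel_measurable M"
    and der: "\<And>t y. t \<in> {a..b} \<Longrightarrow> y \<in> space M \<Longrightarrow>
      ((\<lambda>t. g t y) has_real_derivative g' t y) (at t within {a..b})"
    and bnd': "\<And>t y. t \<in> {a..b} \<Longrightarrow> y \<in> space M \<Longrightarrow> \<bar>g' t y\<bar> \<le> B'"
    and t: "t \<in> {a..b}"
  shows "((\<lambda>t. \<integral>y. g t y \<partial>M) has_real_derivative (\<integral>y. g' t y \<partial>M)) (at t within {a..b})"
proof -
  interpret finite_measure M by fact
  have int: "integrable M (g t)" if "t \<in> {a..b}" for t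
    using that meas bnd by (intro integrable_const_bound[of _ B]) auto
  have lip: "\<bar>g s y - g t y\<bar> \<le> B' * \<bar>s - t\<bar>" if "s \<in> {a..b}" "y \<in> space M" for s y
    using field_differentiable_bound[of "{a..b}" "\<lambda>t. g t y" "\<lambda>t. g' t y" B' s t] that der bnd' t
    by auto
  show ?thesis
    unfolding has_field_derivative_iff tendsto_at_iff_sequentially
  proof (intro allI impI, simp only: comp_def)
    fix X assume X: "\<forall>i. X i \<in> {a..b} - {t}" and Xt: "X \<longlonglongrightarrow> t"
    have "(\<lambda>i. \<integral>y. (g (X i) y - g t y) / (X i - t) \<partial>M) \<longlonglongrightarrow> (\<integral>y. g' t y \<partial>M)"
    proof (rule integral_dominated_convergence[where w="\<lambda>_. B'"])
      show "AE y in M. (\<lambda>i. (g (X i) y - g t y) / (X i - t)) \<longlonglongrightarrow> g' t y"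
      proof (rule AE_I2)
        fix y assume "y \<in> space M"
        then show "(\<lambda>i. (g (X i) y - g t y) / (X i - t)) \<longlonglongrightarrow> g' t y"
          using der[OF t, of y] X Xt unfolding has_field_derivative_iff tendsto_at_iff_sequentially
          by (auto simp: comp_def)
      qed
      show "AE y in M. norm ((g (X i) y - g t y) / (X i - t)) \<le> B'" for i
      proof (rule AE_I2)
        fix y assume "y \<in> space M"
        then show "norm ((g (X i) y - g t y) / (X i - t)) \<le> B'"
          using lip[of "X i" y] X[rule_format, of i] by (auto simp: field_simps)
      qed
    qed (use X t meas meas' in auto)
    moreover have "(\<integral>y. (g (X i) y - g t y) / (X i - t) \<partial>M)
        = ((\<integral>y. g (X i) y \<partial>M) - (\<integral>y. g t y \<partial>M)) / (X i - t)" for i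
      using X int t by (auto simp: Bochner_Integration.integral_diff)
    ultimately show "(\<lambda>i. ((\<integral>y. g (X i) y \<partial>M) - (\<integral>y. g t y \<partial>M)) / (X i - t)) \<longlonglongrightarrow> (\<integral>y. g' t y \<partial>M)"
      by (simp only:)
  qed
qed

lemma C1_lipschitz_on_atLeastAtMost_0:
  fixes p D :: "real \<Rightarrow> real"
  assumes "\<And>x. x \<ge> 0 \<Longrightarrow> (p has_real_derivative D x) (at x within {0..})"
    and "continuous_on {0..} D"
  obtains L where "0 < L" "\<And>x y. x \<in> {0..b} \<Longrightarrow> y \<in> {0..b} \<Longrightarrow> \<bar>p x - p y\<bar> \<le> L * \<bar>x - y\<bar>"
proof -
  have "compact (D ` {0..b})"
    by (intro compact_continuous_image continuous_on_subset[OF assms(2)]) auto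
  then obtain L where L: "0 < L" "\<And>x. x \<in> {0..b} \<Longrightarrow> \<bar>D x\<bar> \<le> L"
    using compact_imp_bounded bounded_pos by (metis imageI real_norm_def)
  have "\<bar>p x - p y\<bar> \<le> L * \<bar>x - y\<bar>" if "x \<in> {0..b}" "y \<in> {0..b}" for x y
    using field_differentiable_bound[of "{0..b}" p D L x y] that L(2)
      has_field_derivative_subset[OF assms(1), of _ "{0..b}"] by auto
  then show ?thesis using L that by blast
qed

section \<open>The truncated flow\<close>

lemma exp_lipschitz_on:
  fixes z z' B :: real
  assumes "z \<le> B" "z' \<le> B"
  shows "\<bar>exp z - exp z'\<bar> \<le> exp B * \<bar>z - z'\<bar>"
  using field_differentiable_bound[of "{..B}" exp exp "exp B" z z'] assms
  by (auto intro!: DERIV_subset[OF DERIV_exp])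

lemma (in prob_space) expectation_diff_le:
  fixes f g :: "'a \<Rightarrow> real"
  assumes "integrable M f" "integrable M g" "AE y in M. \<bar>f y - g y\<bar> \<le> K"
  shows "\<bar>expectation f - expectation g\<bar> \<le> K"
proof -
  have "\<bar>expectation f - expectation g\<bar> = \<bar>\<integral>y. f y - g y \<partial>M\<bar>"
    using assms by simp
  also have "\<dots> \<le> (\<integral>y. \<bar>f y - g y\<bar> \<partial>M)" by (rule integral_abs_bound)
  also have "\<dots> \<le> K" using assms by (intro integral_le_const) auto
  finally show ?thesis .
qed

text \<open>The pressure and its potential are controlled only on the nonnegative half-line.
  Replacing q by x \<mapsto> q(max 0 x) gives a function that is continuous on the whole line and
  agrees with q on the values of f.\<close>

lemma continuous_nonneg_comp_measurable:
  fixes f :: "'b \<Rightarrow> real" and q :: "real \<Rightarrow> real"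
  assumes q: "continuous_on {0..} q" and [measurable]: "f \<in> borel_measurable N"
    and f: "\<And>y. y \<in> space N \<Longrightarrow> 0 \<le> f y"
  shows "(\<lambda>y. q (f y)) \<in> borel_measurable N"
proof -
  have "continuous_on UNIV (\<lambda>x. q (max 0 x))"
    by (intro continuous_on_compose2[OF q] continuous_intros) auto
  then have [measurable]: "(\<lambda>x. q (max 0 x)) \<in> borel_measurable borel"
    by (rule borel_measurable_continuous_onI)
  have "(\<lambda>y. q (max 0 (f y))) \<in> borel_measurable N" by measurable
  then show ?thesis by (rule measurable_cong[THEN iffD1, rotated]) (use f in \<open>simp add: max_def\<close>)
qed

text \<open>\<open>\<rho>\<close> stands for a representative of the initial density whose bounds
  hold everywhere, so that no exceptional set enters the analysis of the flow. \<open>M\<close> will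
  be Lebesgue measure on the unit cube.\<close>

locale lagrangian_flow = prob_space M for M :: "'a measure" +
  fixes \<rho> :: "'a \<Rightarrow> real" and R0 :: real and p D :: "real \<Rightarrow> real"
  assumes \<rho>_meas [measurable]: "\<rho> \<in> borel_measurable M"
    and \<rho>_range: "\<And>y. \<rho> y \<in> {0..R0}"
    and p_der: "\<And>x. x \<ge> 0 \<Longrightarrow> (p has_real_derivative D x) (at x within {0..})"
    and D_cont: "continuous_on {0..} D"
begin

lemma R0_nonneg: "0 \<le> R0" and \<rho>_nonneg: "0 \<le> \<rho> y" and \<rho>_le: "\<rho> y \<le> R0"
  using \<rho>_range[of undefined] \<rho>_range[of y] by auto

lemma p_cont: "continuous_on {0..} p"
  using p_der by (auto simp: continuous_on_eq_continuous_within intro: DERIV_continuous)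

lemma apply_bcontfun_measurable [measurable]:
  "(\<lambda>y. apply_bcontfun u (\<rho> y)) \<in> borel_measurable M" for u :: "real \<Rightarrow>\<^sub>C real"
proof -
  have [measurable]: "apply_bcontfun u \<in> borel_measurable borel"
    by (intro borel_measurable_continuous_onI continuous_on_apply_bcontfun)
  show ?thesis by measurable
qed

text \<open>Here z is the displacement. For |z| \<le> B the density x exp(-z) stays in the compact
  interval [0, R0 exp B], on which p is Lipschitz and bounded. One constant serves both the local
  term p(\<eta>) and the integrand p(\<eta>) exp(z) of the mean.\<close>

lemma pressure_exp_lipschitz:
  obtains L where "0 < L"
    "\<And>x z z'. x \<in> {0..R0} \<Longrightarrow> \<bar>z\<bar> \<le> B \<Longrightarrow> \<bar>z'\<bar> \<le> B \<Longrightarrow>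
      \<bar>p (x * exp (- z)) - p (x * exp (- z'))\<bar> \<le> L * \<bar>z - z'\<bar>"
    "\<And>x z z'. x \<in> {0..R0} \<Longrightarrow> \<bar>z\<bar> \<le> B \<Longrightarrow> \<bar>z'\<bar> \<le> B \<Longrightarrow>
      \<bar>p (x * exp (- z)) * exp z - p (x * exp (- z')) * exp z'\<bar> \<le> L * \<bar>z - z'\<bar>"
    "\<And>x z. x \<in> {0..R0} \<Longrightarrow> \<bar>z\<bar> \<le> B \<Longrightarrow> \<bar>p (x * exp (- z))\<bar> \<le> L"
    "\<And>x z. x \<in> {0..R0} \<Longrightarrow> \<bar>z\<bar> \<le> B \<Longrightarrow> \<bar>p (x * exp (- z)) * exp z\<bar> \<le> L"
proof -
  define b where "b = R0 * exp B"
  obtain L0 where L0: "0 < L0"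
    "\<And>x y. x \<in> {0..b} \<Longrightarrow> y \<in> {0..b} \<Longrightarrow> \<bar>p x - p y\<bar> \<le> L0 * \<bar>x - y\<bar>"
    using C1_lipschitz_on_atLeastAtMost_0[OF p_der D_cont] by metis
  have b: "0 \<le> b" using R0_nonneg by (simp add: b_def)
  define S where "S = \<bar>p 0\<bar> + L0 * b"
  define L1 where "L1 = L0 * (R0 * exp B)"
  define L where "L = 1 + S + S * exp B + L1 + L1 * exp B"
  have nn: "0 \<le> S" "0 \<le> L1" "0 \<le> S * exp B" "0 \<le> L1 * exp B"
    using L0 b R0_nonneg by (auto simp: S_def L1_def)
  have rng: "x * exp (- z) \<in> {0..b}" if "x \<in> {0..R0}" "\<bar>z\<bar> \<le> B" for x z
    using that unfolding b_def by (auto intro!: mult_mono)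
  have pb: "\<bar>p (x * exp (- z))\<bar> \<le> S" if "x \<in> {0..R0}" "\<bar>z\<bar> \<le> B" for x z
  proof -
    have "\<bar>p (x * exp (- z)) - p 0\<bar> \<le> L0 * \<bar>x * exp (- z) - 0\<bar>"
      using rng[OF that] b by (intro L0) auto
    also have "\<dots> \<le> L0 * b" using rng[OF that] L0 by (intro mult_left_mono) auto
    finally show ?thesis by (auto simp: S_def)
  qed
  have lip1: "\<bar>p (x * exp (- z)) - p (x * exp (- z'))\<bar> \<le> L1 * \<bar>z - z'\<bar>"
    if "x \<in> {0..R0}" "\<bar>z\<bar> \<le> B" "\<bar>z'\<bar> \<le> B" for x z z'
  proof -
    have "\<bar>p (x * exp (- z)) - p (x * exp (- z'))\<bar> \<le> L0 * \<bar>x * exp (- z) - x * exp (- z')\<bar>"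
      using that by (intro L0 rng)
    also have "\<bar>x * exp (- z) - x * exp (- z')\<bar> = x * \<bar>exp (- z) - exp (- z')\<bar>"
      using that by (simp add: abs_mult flip: right_diff_distrib)
    also have "L0 * (x * \<bar>exp (- z) - exp (- z')\<bar>) \<le> L0 * (R0 * (exp B * \<bar>- z - - z'\<bar>))"
      using that L0 R0_nonneg by (intro mult_left_mono mult_mono exp_lipschitz_on) auto
    also have "\<dots> = L1 * \<bar>z - z'\<bar>" by (simp add: L1_def abs_minus_commute)
    finally show ?thesis .
  qed
  have lip2: "\<bar>p (x * exp (- z)) * exp z - p (x * exp (- z')) * exp z'\<bar> \<le> (L1 * exp B + S * exp B) * \<bar>z - z'\<bar>"
    if "x \<in> {0..R0}" "\<bar>z\<bar> \<le> B" "\<bar>z'\<bar> \<le> B" for x z z'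
  proof -
    have "p (x * exp (- z)) * exp z - p (x * exp (- z')) * exp z'
      = (p (x * exp (- z)) - p (x * exp (- z'))) * exp z + p (x * exp (- z')) * (exp z - exp z')"
      by (simp add: algebra_simps)
    also have "\<bar>\<dots>\<bar> \<le> \<bar>p (x * exp (- z)) - p (x * exp (- z'))\<bar> * exp z + \<bar>p (x * exp (- z'))\<bar> * \<bar>exp z - exp z'\<bar>"
      by (rule order_trans[OF abs_triangle_ineq]) (simp add: abs_mult)
    also have "\<dots> \<le> (L1 * \<bar>z - z'\<bar>) * exp B + S * (exp B * \<bar>z - z'\<bar>)"
      using that nn by (intro add_mono mult_mono lip1 pb exp_lipschitz_on) auto
    finally show ?thesis by (simp add: algebra_simps)
  qed
  show ?thesis
  proof
    show "0 < L" unfolding L_def using nn by linarith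
    fix x z assume x: "x \<in> {0..R0}" and z: "\<bar>z\<bar> \<le> B"
    show "\<bar>p (x * exp (- z))\<bar> \<le> L" unfolding L_def using pb[OF x z] nn by linarith
    have "\<bar>p (x * exp (- z)) * exp z\<bar> \<le> S * exp B"
      using pb[OF x z] nn z by (auto simp: abs_mult intro!: mult_mono)
    then show "\<bar>p (x * exp (- z)) * exp z\<bar> \<le> L" unfolding L_def using nn by linarith
    fix z' assume z': "\<bar>z'\<bar> \<le> B"
    have "L1 * \<bar>z - z'\<bar> \<le> L * \<bar>z - z'\<bar>" "(L1 * exp B + S * exp B) * \<bar>z - z'\<bar> \<le> L * \<bar>z - z'\<bar>"
      unfolding L_def using nn by (intro mult_right_mono; linarith)+
    then show "\<bar>p (x * exp (- z)) - p (x * exp (- z'))\<bar> \<le> L * \<bar>z - z'\<bar>"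
      "\<bar>p (x * exp (- z)) * exp z - p (x * exp (- z')) * exp z'\<bar> \<le> L * \<bar>z - z'\<bar>"
      using lip1[OF x z z'] lip2[OF x z z'] by linarith+
  qed
qed

text \<open>The truncation c is 1-Lipschitz with values in [-B,B], so composing with it turns the
  local Lipschitz bounds on the ball of radius B into global ones.\<close>

lemma truncated_flow_exists:
  assumes B: "0 < B" and T: "0 \<le> T"
  defines "c \<equiv> \<lambda>z. max (- B) (min B z)"
  obtains u :: "real \<Rightarrow> real \<Rightarrow>\<^sub>C real" where "continuous_on {0..T} u" "u 0 = 0"
    "\<And>t x. t \<in> {0..T} \<Longrightarrow> x \<in> {0..R0} \<Longrightarrow> ((\<lambda>t. apply_bcontfun (u t) x) has_real_derivative
       p (x * exp (- c (apply_bcontfun (u t) x)))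
       - (\<integral>y. p (\<rho> y * exp (- c (apply_bcontfun (u t) (\<rho> y)))) * exp (c (apply_bcontfun (u t) (\<rho> y))) \<partial>M))
       (at t within {0..T})"
proof -
  obtain L where L: "0 < L"
    "\<And>x z z'. x \<in> {0..R0} \<Longrightarrow> \<bar>z\<bar> \<le> B \<Longrightarrow> \<bar>z'\<bar> \<le> B \<Longrightarrow>
      \<bar>p (x * exp (- z)) - p (x * exp (- z'))\<bar> \<le> L * \<bar>z - z'\<bar>"
    "\<And>x z z'. x \<in> {0..R0} \<Longrightarrow> \<bar>z\<bar> \<le> B \<Longrightarrow> \<bar>z'\<bar> \<le> B \<Longrightarrow>
      \<bar>p (x * exp (- z)) * exp z - p (x * exp (- z')) * exp z'\<bar> \<le> L * \<bar>z - z'\<bar>"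
    "\<And>x z. x \<in> {0..R0} \<Longrightarrow> \<bar>z\<bar> \<le> B \<Longrightarrow> \<bar>p (x * exp (- z))\<bar> \<le> L"
    "\<And>x z. x \<in> {0..R0} \<Longrightarrow> \<bar>z\<bar> \<le> B \<Longrightarrow> \<bar>p (x * exp (- z)) * exp z\<bar> \<le> L"
    using pressure_exp_lipschitz[of B] by blast
  have c: "\<bar>c z\<bar> \<le> B" "\<bar>c z - c z'\<bar> \<le> \<bar>z - z'\<bar>" for z z'
    using B by (auto simp: c_def)
  have cc [continuous_intros]: "continuous_on S (\<lambda>x. c (f x))" if "continuous_on S f"
    for S :: "real set" and f using that unfolding c_def by (intro continuous_intros)
  have cm [measurable]: "c \<in> borel_measurable borel" unfolding c_def by measurable
  \<comment> \<open>Only densities in [0,R0] matter; clamping x makes the right-hand side a bounded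
    continuous function on the whole line, as membership in the Banach space requires.\<close>
  define k where "k x = max 0 (min R0 x)" for x
  have k: "k x \<in> {0..R0}" "0 \<le> k x" "x \<in> {0..R0} \<Longrightarrow> k x = x" for x
    using R0_nonneg by (auto simp: k_def)
  define m where "m u = (\<integral>y. p (\<rho> y * exp (- c (apply_bcontfun u (\<rho> y)))) * exp (c (apply_bcontfun u (\<rho> y))) \<partial>M)"
    for u :: "real \<Rightarrow>\<^sub>C real"
  define f where "f u x = p (k x * exp (- c (apply_bcontfun u x))) - m u" for u :: "real \<Rightarrow>\<^sub>C real" and x
  have int: "integrable M (\<lambda>y. p (\<rho> y * exp (- c (apply_bcontfun u (\<rho> y)))) * exp (c (apply_bcontfun u (\<rho> y))))"
    for u :: "real \<Rightarrow>\<^sub>C real"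
    using \<rho>_nonneg c L(5)[OF \<rho>_range]
    by (intro integrable_const_bound[of _ L] borel_measurable_times continuous_nonneg_comp_measurable[OF p_cont])
       auto
  have fb: "f u \<in> bcontfun" for u
  proof (rule bcontfun_normI)
    show "continuous_on UNIV (f u)" unfolding f_def
      by (intro continuous_intros continuous_on_compose2[OF p_cont]) (auto simp: k k_def intro!: continuous_intros)
    show "norm (f u x) \<le> L + \<bar>m u\<bar>" for x
      unfolding f_def using L(4)[OF k(1) c(1)] by (simp add: abs_le_iff) (smt (verit))
  qed
  define F where "F u = Bcontfun (f u)" for u
  have F: "apply_bcontfun (F u) = f u" for u unfolding F_def by (rule Bcontfun_inverse[OF fb])
  have ap: "\<bar>apply_bcontfun u x - apply_bcontfun v x\<bar> \<le> norm (u - v)" for u v :: "real \<Rightarrow>\<^sub>C real" and x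
    using norm_bounded[of "u - v" x] by simp
  have clip: "L * \<bar>c (apply_bcontfun u x) - c (apply_bcontfun v x)\<bar> \<le> L * norm (u - v)" for u v :: "real \<Rightarrow>\<^sub>C real" and x
    using L(1) order_trans[OF c(2) ap] by simp
  have m: "\<bar>m u - m v\<bar> \<le> L * norm (u - v)" for u v
    unfolding m_def
    by (intro expectation_diff_le int AE_I2 order_trans[OF L(3)[OF \<rho>_range c(1) c(1)] clip])
  \<comment> \<open>One L comes from the local term and one from the mean.\<close>
  have "norm (F u - F v) \<le> (2 * L) * norm (u - v)" for u v
  proof (rule norm_bound)
    fix x
    have "\<bar>p (k x * exp (- c (apply_bcontfun u x))) - p (k x * exp (- c (apply_bcontfun v x)))\<bar> \<le> L * norm (u - v)"
      by (rule order_trans[OF L(2)[OF k(1) c(1) c(1)] clip])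
    then show "norm (apply_bcontfun (F u - F v) x) \<le> 2 * L * norm (u - v)"
      using m[of u v] by (simp add: F f_def)
  qed
  then obtain u where u: "continuous_on {0..T} u" "u 0 = 0"
    "\<And>t. t \<in> {0..T} \<Longrightarrow> (u has_vector_derivative F (u t)) (at t within {0..T})"
    using picard_global[of "2 * L" F T] L(1) T by auto
  \<comment> \<open>Evaluation at x is bounded and linear, so the Banach-space equation can be read
    off pointwise.\<close>
  have bl: "bounded_linear (\<lambda>f. apply_bcontfun f x)" for x :: real
    by (rule bounded_linear_intro[where K=1]) (auto simp: norm_bounded)
  show ?thesis
  proof (rule that[OF u(1,2)])
    fix t x assume t: "t \<in> {0..T}" and x: "x \<in> {0..R0}"
    show "((\<lambda>t. apply_bcontfun (u t) x) has_real_derivative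
       p (x * exp (- c (apply_bcontfun (u t) x)))
       - (\<integral>y. p (\<rho> y * exp (- c (apply_bcontfun (u t) (\<rho> y)))) * exp (c (apply_bcontfun (u t) (\<rho> y))) \<partial>M))
       (at t within {0..T})"
      using bounded_linear.has_vector_derivative[OF bl u(3)[OF t], of x] k(3)[OF x]
      unfolding has_real_derivative_iff_has_vector_derivative F f_def m_def by simp
  qed
qed

end

section \<open>A priori bounds\<close>

text \<open>Suppose f t > r and let s be the last time up to t with f s \<le> r. Continuity gives f
  s = r, and the negative derivative pushes f below r just after s, contradicting the choice of s.
  Only times of contact with r are tested.\<close>

lemma barrier_not_crossed:
  fixes f :: "real \<Rightarrow> real"
  assumes cont: "continuous_on {a..b} f" and "f a \<le> r"
    and der: "\<And>t. t \<in> {a..b} \<Longrightarrow> f t = r \<Longrightarrow> \<exists>l<0. (f has_real_derivative l) (at t within {a..b})"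
    and t: "t \<in> {a..b}"
  shows "f t \<le> r"
proof (rule ccontr)
  assume "\<not> f t \<le> r"
  define A where "A = {s \<in> {a..t}. f s \<le> r}"
  have ct: "continuous_on {a..t} f" using cont t by (auto intro: continuous_on_subset)
  have "A = {a..t} \<inter> f -` {..r}" by (auto simp: A_def)
  then have A: "closed A" using ct by (simp add: continuous_closed_preimage)
  define s where "s = Sup A"
  have "a \<in> A" using t assms by (auto simp: A_def)
  moreover have bdd: "bdd_above A" by (auto simp: A_def intro!: bdd_aboveI[of _ t])
  ultimately have "s \<in> A" unfolding s_def using A by (intro closed_contains_Sup) auto
  then have s: "a \<le> s" "s \<le> t" "f s \<le> r" by (auto simp: A_def)
  have above: "f x > r" if "s < x" "x \<le> t" for x
    using that cSup_upper[OF _ bdd, of x] s unfolding s_def A_def by force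
  have st: "s < t" using s \<open>\<not> f t \<le> r\<close> by (cases "s = t") auto
  have fs: "f s = r"
  proof (rule ccontr)
    assume "f s \<noteq> r"
    obtain x where "s \<le> x" "x \<le> t" "f x = r"
      using IVT'[of f s r t] s st \<open>\<not> f t \<le> r\<close> continuous_on_subset[OF ct, of "{s..t}"] by auto
    then show False using above[of x] \<open>f s \<noteq> r\<close> by (cases "x = s") auto
  qed
  obtain l where "l < 0" "(f has_real_derivative l) (at s within {a..b})"
    using der[of s] fs s t by auto
  then obtain d where d: "d > 0" "\<And>h. h > 0 \<Longrightarrow> s + h \<in> {a..b} \<Longrightarrow> h < d \<Longrightarrow> f (s + h) < f s"
    using has_real_derivative_neg_dec_right by metis
  define h where "h = min (d / 2) (t - s)"
  have "h > 0" "h < d" "s + h \<le> t" using d st by (auto simp: h_def)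
  then show False using d(2)[of h] above[of "s + h"] fs s t by auto
qed

text \<open>The constants \<open>rhobar\<close> and \<open>C1\<close> of the potential are absorbed
  in the differential equation x P' = p + P - C2, the product rule applied to its defining formula.
  The value at 0 is the one this equation forces at x = 0.\<close>

locale pressure_potential = lagrangian_flow +
  fixes C C2 :: real and P :: "real \<Rightarrow> real"
  assumes p_lower: "\<And>x. 0 \<le> x \<Longrightarrow> - C \<le> p x"
    and p_unbounded: "\<And>K. \<exists>x\<ge>0. K < p x"
    and P_cont: "continuous_on {0..} P"
    and P_der: "\<And>x. 0 < x \<Longrightarrow> (P has_real_derivative (p x + P x - C2) / x) (at x)"
    and P_0: "P 0 = C2 - p 0"
    and p_le_P: "\<And>x. 0 \<le> x \<Longrightarrow> p x \<le> C * P x"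
    and C_pos: "0 < C"
begin

text \<open>The a priori estimates concern any bounded solution of the untruncated equation on
  [0,\<tau>]. The endpoint \<tau> is kept free because they are applied on growing intervals on
  which the truncation is already known to be inactive.\<close>

context
  fixes u :: "real \<Rightarrow> real \<Rightarrow> real" and m :: "real \<Rightarrow> real" and \<tau> B :: real
  assumes u_0: "\<And>x. x \<in> {0..R0} \<Longrightarrow> u 0 x = 0"
    and u_bound: "\<And>t x. t \<in> {0..\<tau>} \<Longrightarrow> x \<in> {0..R0} \<Longrightarrow> \<bar>u t x\<bar> \<le> B"
    and u_meas: "\<And>t. t \<in> {0..\<tau>} \<Longrightarrow> (\<lambda>y. u t (\<rho> y)) \<in> borel_measurable M"
    and m: "\<And>t. t \<in> {0..\<tau>} \<Longrightarrow> m t = (\<integral>y. p (\<rho> y * exp (- u t (\<rho> y))) * exp (u t (\<rho> y)) \<partial>M)"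
    and u_der: "\<And>t x. t \<in> {0..\<tau>} \<Longrightarrow> x \<in> {0..R0} \<Longrightarrow>
      ((\<lambda>t. u t x) has_real_derivative p (x * exp (- u t x)) - m t) (at t within {0..\<tau>})"
begin

lemma eta_nonneg: "x \<in> {0..R0} \<Longrightarrow> 0 \<le> x * exp (- u t x)"
  by auto

lemma p_eta_measurable:
  "t \<in> {0..\<tau>} \<Longrightarrow> (\<lambda>y. p (\<rho> y * exp (- u t (\<rho> y)))) \<in> borel_measurable M"
  using u_meas \<rho>_nonneg by (intro continuous_nonneg_comp_measurable[OF p_cont]) auto

lemma p_eta_bounds:
  obtains L where "0 < L" "\<And>t x. t \<in> {0..\<tau>} \<Longrightarrow> x \<in> {0..R0} \<Longrightarrow> \<bar>p (x * exp (- u t x))\<bar> \<le> L"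
    "\<And>t x. t \<in> {0..\<tau>} \<Longrightarrow> x \<in> {0..R0} \<Longrightarrow> \<bar>p (x * exp (- u t x)) * exp (u t x)\<bar> \<le> L"
    "\<And>t. t \<in> {0..\<tau>} \<Longrightarrow> \<bar>m t\<bar> \<le> L"
    "\<And>t x. t \<in> {0..\<tau>} \<Longrightarrow> x \<in> {0..R0} \<Longrightarrow> exp (u t x) \<le> L"
proof -
  obtain L where L: "0 < L"
    "\<And>x z z'. x \<in> {0..R0} \<Longrightarrow> \<bar>z\<bar> \<le> B \<Longrightarrow> \<bar>z'\<bar> \<le> B \<Longrightarrow>
      \<bar>p (x * exp (- z)) - p (x * exp (- z'))\<bar> \<le> L * \<bar>z - z'\<bar>"
    "\<And>x z z'. x \<in> {0..R0} \<Longrightarrow> \<bar>z\<bar> \<le> B \<Longrightarrow> \<bar>z'\<bar> \<le> B \<Longrightarrow>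
      \<bar>p (x * exp (- z)) * exp z - p (x * exp (- z')) * exp z'\<bar> \<le> L * \<bar>z - z'\<bar>"
    "\<And>x z. x \<in> {0..R0} \<Longrightarrow> \<bar>z\<bar> \<le> B \<Longrightarrow> \<bar>p (x * exp (- z))\<bar> \<le> L"
    "\<And>x z. x \<in> {0..R0} \<Longrightarrow> \<bar>z\<bar> \<le> B \<Longrightarrow> \<bar>p (x * exp (- z)) * exp z\<bar> \<le> L"
    using pressure_exp_lipschitz[of B] by blast
  have "\<bar>m t\<bar> \<le> L" if t: "t \<in> {0..\<tau>}" for t
  proof -
    have "\<bar>m t\<bar> \<le> (\<integral>y. \<bar>p (\<rho> y * exp (- u t (\<rho> y))) * exp (u t (\<rho> y))\<bar> \<partial>M)"
      unfolding m[OF t] by (rule integral_abs_bound)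
    also have "\<dots> \<le> L"
      using L(5)[OF \<rho>_range u_bound[OF t \<rho>_range]] p_eta_measurable[OF t] u_meas[OF t]
      by (intro integral_le_const integrable_const_bound[of _ L]) auto
    finally show ?thesis .
  qed
  moreover have "exp (u t x) \<le> exp B" if "t \<in> {0..\<tau>}" "x \<in> {0..R0}" for t x
    using u_bound[OF that] by auto
  ultimately have "0 < L + exp B" "\<And>t x. t \<in> {0..\<tau>} \<Longrightarrow> x \<in> {0..R0} \<Longrightarrow> exp (u t x) \<le> L + exp B"
    "\<And>t. t \<in> {0..\<tau>} \<Longrightarrow> \<bar>m t\<bar> \<le> L + exp B"
    using L(1) by (smt (verit) exp_gt_zero)+
  moreover have "\<bar>p (x * exp (- u t x))\<bar> \<le> L + exp B" "\<bar>p (x * exp (- u t x)) * exp (u t x)\<bar> \<le> L + exp B"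
    if "t \<in> {0..\<tau>}" "x \<in> {0..R0}" for t x
    using L(4,5)[OF that(2) u_bound[OF that]] by (smt (verit) exp_gt_zero)+
  ultimately show ?thesis using that by blast
qed

text \<open>Differentiating under the integral, the mean I of exp(u) satisfies I' = m (1 - I),
  because m is itself the mean of p(\<eta>) exp(u). The initial value 1 is the equilibrium of this
  linear equation.\<close>

lemma mass_conserved:
  assumes t: "t \<in> {0..\<tau>}"
  shows "(\<integral>y. exp (u t (\<rho> y)) \<partial>M) = 1"
proof -
  define I where "I t = (\<integral>y. exp (u t (\<rho> y)) \<partial>M)" for t
  obtain L where L: "0 < L" "\<And>t x. t \<in> {0..\<tau>} \<Longrightarrow> x \<in> {0..R0} \<Longrightarrow> \<bar>p (x * exp (- u t x))\<bar> \<le> L"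
    "\<And>t x. t \<in> {0..\<tau>} \<Longrightarrow> x \<in> {0..R0} \<Longrightarrow> \<bar>p (x * exp (- u t x)) * exp (u t x)\<bar> \<le> L"
    "\<And>t. t \<in> {0..\<tau>} \<Longrightarrow> \<bar>m t\<bar> \<le> L"
    "\<And>t x. t \<in> {0..\<tau>} \<Longrightarrow> x \<in> {0..R0} \<Longrightarrow> exp (u t x) \<le> L"
    using p_eta_bounds by blast
  have dI: "(I has_real_derivative m t * (1 - I t)) (at t within {0..\<tau>})" if t: "t \<in> {0..\<tau>}" for t
  proof -
    have "(I has_real_derivative (\<integral>y. exp (u t (\<rho> y)) * (p (\<rho> y * exp (- u t (\<rho> y))) - m t) \<partial>M)) (at t within {0..\<tau>})"
      unfolding I_def
    proof (rule has_real_derivative_integral_param[where B=L and B'="L * (L + L)"])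
      fix t y assume t: "t \<in> {0..\<tau>}"
      show "((\<lambda>t. exp (u t (\<rho> y))) has_real_derivative exp (u t (\<rho> y)) * (p (\<rho> y * exp (- u t (\<rho> y))) - m t)) (at t within {0..\<tau>})"
        by (auto intro!: derivative_eq_intros u_der[OF t \<rho>_range])
      show "\<bar>exp (u t (\<rho> y)) * (p (\<rho> y * exp (- u t (\<rho> y))) - m t)\<bar> \<le> L * (L + L)"
        using L(1) L(2,5)[OF t \<rho>_range, of y] L(4)[OF t] unfolding abs_mult
        by (intro mult_mono) auto
    qed (use t L(5) \<rho>_range u_meas p_eta_measurable in \<open>auto intro!: borel_measurable_times borel_measurable_diff finite_measure_axioms\<close>)
    moreover have "(\<integral>y. exp (u t (\<rho> y)) * (p (\<rho> y * exp (- u t (\<rho> y))) - m t) \<partial>M) = m t * (1 - I t)"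
    proof -
      have "integrable M (\<lambda>y. p (\<rho> y * exp (- u t (\<rho> y))) * exp (u t (\<rho> y)))"
        using L(3)[OF t \<rho>_range] p_eta_measurable[OF t] u_meas[OF t] by (intro integrable_const_bound[of _ L]) auto
      moreover have "integrable M (\<lambda>y. m t * exp (u t (\<rho> y)))"
        using L(5)[OF t \<rho>_range] u_meas[OF t] by (intro integrable_mult_right integrable_const_bound[of _ L]) auto
      ultimately have "(\<integral>y. p (\<rho> y * exp (- u t (\<rho> y))) * exp (u t (\<rho> y)) - m t * exp (u t (\<rho> y)) \<partial>M) = m t - m t * I t"
        by (simp add: m[OF t] I_def)
      then show ?thesis by (simp add: algebra_simps)
    qed
    ultimately show ?thesis by (simp only:)
  qed
  \<comment> \<open>The trajectory starting from density 0 solves u' = p 0 - m, so that exp (p 0 * t - u t 0) is the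
    integrating factor of the linear equation for 1 - I.\<close>
  have "((\<lambda>t. (1 - I t) * exp (p 0 * t - u t 0)) has_real_derivative 0) (at t within {0..\<tau>})"
    if t: "t \<in> {0..\<tau>}" for t
  proof -
    have "0 \<in> {0..R0}" using R0_nonneg by auto
    from u_der[OF t this] show ?thesis
      by (auto intro!: derivative_eq_intros dI[OF t] simp: algebra_simps)
  qed
  then obtain c where c: "\<And>t. t \<in> {0..\<tau>} \<Longrightarrow> (1 - I t) * exp (p 0 * t - u t 0) = c"
    using has_field_derivative_zero_constant[of "{0..\<tau>}" "\<lambda>t. (1 - I t) * exp (p 0 * t - u t 0)"] by auto
  have "I 0 = 1" unfolding I_def using u_0 \<rho>_range by (simp add: prob_space)
  then have "c = 0" using c[of 0] t by auto
  then have "1 - I t = 0" using c[OF t] by simp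
  then show ?thesis by (simp add: I_def)
qed

text \<open>Since P satisfies x P'(x) - P(x) = p(x) - C2 and the mean of p - m against exp u vanishes, the energy
  dissipates at the rate given by the mean of the square of p - m.\<close>

lemma energy_decreasing:
  assumes t: "t \<in> {0..\<tau>}"
  shows "(\<integral>y. P (\<rho> y * exp (- u t (\<rho> y))) * exp (u t (\<rho> y)) \<partial>M) \<le> (\<integral>y. P (\<rho> y) \<partial>M)"
    and "integrable M (\<lambda>y. P (\<rho> y * exp (- u t (\<rho> y))) * exp (u t (\<rho> y)))"
proof -
  define E where "E t = (\<integral>y. P (\<rho> y * exp (- u t (\<rho> y))) * exp (u t (\<rho> y)) \<partial>M)" for t
  obtain L where L: "0 < L" "\<And>t x. t \<in> {0..\<tau>} \<Longrightarrow> x \<in> {0..R0} \<Longrightarrow> \<bar>p (x * exp (- u t x))\<bar> \<le> L"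
    "\<And>t x. t \<in> {0..\<tau>} \<Longrightarrow> x \<in> {0..R0} \<Longrightarrow> \<bar>p (x * exp (- u t x)) * exp (u t x)\<bar> \<le> L"
    "\<And>t. t \<in> {0..\<tau>} \<Longrightarrow> \<bar>m t\<bar> \<le> L"
    "\<And>t x. t \<in> {0..\<tau>} \<Longrightarrow> x \<in> {0..R0} \<Longrightarrow> exp (u t x) \<le> L"
    using p_eta_bounds by blast
  have "compact (P ` {0..R0 * exp B})"
    by (intro compact_continuous_image continuous_on_subset[OF P_cont]) auto
  then obtain K where K: "0 < K" "\<And>x. x \<in> {0..R0 * exp B} \<Longrightarrow> \<bar>P x\<bar> \<le> K"
    using compact_imp_bounded bounded_pos by (metis imageI real_norm_def)
  have Pb: "\<bar>P (x * exp (- u t x)) * exp (u t x)\<bar> \<le> K * L" if "t \<in> {0..\<tau>}" "x \<in> {0..R0}" for t x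
  proof -
    have "x * exp (- u t x) \<le> R0 * exp B"
      using u_bound[OF that] that(2) by (intro mult_mono) auto
    then show ?thesis unfolding abs_mult using K(2)[of "x * exp (- u t x)"] L(5)[OF that] that K(1)
      by (intro mult_mono) auto
  qed
  have Pm: "(\<lambda>y. P (\<rho> y * exp (- u t (\<rho> y)))) \<in> borel_measurable M" if "t \<in> {0..\<tau>}" for t
    using u_meas[OF that] \<rho>_nonneg by (intro continuous_nonneg_comp_measurable[OF P_cont]) auto
  show "integrable M (\<lambda>y. P (\<rho> y * exp (- u t (\<rho> y))) * exp (u t (\<rho> y)))"
    using Pb[OF t \<rho>_range] Pm[OF t] u_meas[OF t] by (intro integrable_const_bound[of _ "K * L"]) auto
  \<comment> \<open>From \<eta>' = -\<eta> (p - m) and \<eta> P'(\<eta>) = p + P - C2, the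
    derivative of P(\<eta>) exp(u) is -(p + P - C2)(p - m) exp(u) + P (p - m) exp(u); the two terms
    in P cancel.\<close>
  define g' where "g' t y = - (p (\<rho> y * exp (- u t (\<rho> y))) - C2) * exp (u t (\<rho> y)) * (p (\<rho> y * exp (- u t (\<rho> y))) - m t)"
    for t y
  have g'b: "\<bar>g' t y\<bar> \<le> (L + \<bar>C2\<bar>) * L * (L + L)" if "t \<in> {0..\<tau>}" for t y
    unfolding g'_def abs_mult using L(1) L(2,5)[OF that \<rho>_range, of y] L(4)[OF that]
    by (intro mult_mono) auto
  have g'm: "g' t \<in> borel_measurable M" if "t \<in> {0..\<tau>}" for t
    unfolding g'_def using p_eta_measurable[OF that] u_meas[OF that] by measurable
  have dE: "(E has_real_derivative (\<integral>y. g' t y \<partial>M)) (at t within {0..\<tau>})" if t: "t \<in> {0..\<tau>}" for t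
    unfolding E_def
  proof (rule has_real_derivative_integral_param[where B="K * L" and B'="(L + \<bar>C2\<bar>) * L * (L + L)"])
    fix t y assume t: "t \<in> {0..\<tau>}"
    let ?e = "\<lambda>t. \<rho> y * exp (- u t (\<rho> y))"
    note du = u_der[OF t \<rho>_range, of y]
    show "((\<lambda>t. P (?e t) * exp (u t (\<rho> y))) has_real_derivative g' t y) (at t within {0..\<tau>})"
    \<comment> \<open>The differential equation for P is available only at positive densities. In
      vacuum \<eta> stays 0 and the derivative is P(0)(p(0) - m) exp(u), which matches g' thanks to
      \<open>P_0\<close>.\<close>
    proof (cases "\<rho> y = 0")
      case True
      then show ?thesis using du unfolding g'_def
        by (auto intro!: derivative_eq_intros simp: P_0 algebra_simps)
    next
      case False
      then have e: "0 < ?e t" using \<rho>_nonneg[of y] by simp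
      have de: "(?e has_real_derivative - ?e t * (p (?e t) - m t)) (at t within {0..\<tau>})"
        using du by (auto intro!: derivative_eq_intros simp: algebra_simps)
      have cancel: "a / e * (- e * b) = - a * b" if "0 < e" for a b e :: real
        using that by simp
      have dP: "((\<lambda>t. P (?e t)) has_real_derivative (p (?e t) + P (?e t) - C2) / ?e t * (- ?e t * (p (?e t) - m t))) (at t within {0..\<tau>})"
        by (rule DERIV_chain2[OF P_der[OF e] de])
      have "(p (?e t) + P (?e t) - C2) / ?e t * (- ?e t * (p (?e t) - m t)) = - (p (?e t) + P (?e t) - C2) * (p (?e t) - m t)"
        using cancel[of "?e t"] e by blast
      note dP = dP[unfolded this]
      have "((\<lambda>t. P (?e t) * exp (u t (\<rho> y))) has_real_derivative
         (- (p (?e t) + P (?e t) - C2) * (p (?e t) - m t)) * exp (u t (\<rho> y)) + P (?e t) * (exp (u t (\<rho> y)) * (p (?e t) - m t)))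
         (at t within {0..\<tau>})"
        by (rule derivative_eq_intros dP du refl)+ simp
      then show ?thesis unfolding g'_def by (rule DERIV_cong) (simp add: algebra_simps)
    qed
  qed (use t Pb Pm g'b g'm \<rho>_range u_meas in \<open>auto intro!: borel_measurable_times finite_measure_axioms\<close>)
  have nonpos: "(\<integral>y. g' t y \<partial>M) \<le> 0" if t: "t \<in> {0..\<tau>}" for t
  proof -
    have i1: "integrable M (\<lambda>y. p (\<rho> y * exp (- u t (\<rho> y))) * exp (u t (\<rho> y)))"
      using L(3)[OF t \<rho>_range] p_eta_measurable[OF t] u_meas[OF t] by (intro integrable_const_bound[of _ L]) auto
    have i2: "integrable M (\<lambda>y. exp (u t (\<rho> y)))"
      using L(5)[OF t \<rho>_range] u_meas[OF t] by (intro integrable_const_bound[of _ L]) auto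
    \<comment> \<open>Uses -(p - C2)(p - m) = (C2 - m)(p - m) - (p - m)^2: discarding the square
      leaves a multiple of p - m, whose mean against exp(u) is m - m * 1 by conservation of
      mass.\<close>
    have "(\<integral>y. g' t y \<partial>M) \<le> (\<integral>y. (C2 - m t) * (p (\<rho> y * exp (- u t (\<rho> y))) * exp (u t (\<rho> y)) - m t * exp (u t (\<rho> y))) \<partial>M)"
    proof (rule integral_mono)
      show "integrable M (g' t)"
        using g'b[OF t] g'm[OF t] by (intro integrable_const_bound[of _ "(L + \<bar>C2\<bar>) * L * (L + L)"]) auto
      fix y
      have "(C2 - m t) * (p (\<rho> y * exp (- u t (\<rho> y))) * exp (u t (\<rho> y)) - m t * exp (u t (\<rho> y)))
        = g' t y + (p (\<rho> y * exp (- u t (\<rho> y))) - m t)\<^sup>2 * exp (u t (\<rho> y))"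
        unfolding g'_def by (simp add: algebra_simps power2_eq_square)
      then show "g' t y \<le> (C2 - m t) * (p (\<rho> y * exp (- u t (\<rho> y))) * exp (u t (\<rho> y)) - m t * exp (u t (\<rho> y)))"
        by simp
    qed (use i1 i2 in auto)
    also have "\<dots> = (C2 - m t) * (m t - m t * 1)"
      using i1 i2 by (simp add: mass_conserved[OF t] m[OF t])
    finally show ?thesis by simp
  qed
  have "E t \<le> E 0"
  proof (rule DERIV_nonpos_imp_decreasing_open[of 0 t E])
    show "continuous_on {0..t} E"
      by (rule continuous_on_subset[OF DERIV_continuous_on[OF dE]]) (use t in auto)
    fix s assume s: "0 < s" "s < t"
    then have "at s within {0..\<tau>} = at s" using t by (intro at_within_interior) auto
    then show "\<exists>y. (E has_real_derivative y) (at s) \<and> y \<le> 0"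
      using dE[of s] nonpos[of s] s t by auto
  qed (use t in auto)
  also have "E 0 = (\<integral>y. P (\<rho> y) \<partial>M)" unfolding E_def using u_0 \<rho>_range by simp
  finally show "(\<integral>y. P (\<rho> y * exp (- u t (\<rho> y))) * exp (u t (\<rho> y)) \<partial>M) \<le> (\<integral>y. P (\<rho> y) \<partial>M)"
    by (simp add: E_def)
qed

text \<open>Since exp(u) has mean 1, m is a weighted average of the pressure, so the pointwise lower
  bound is inherited. For the upper bound, p \<le> C P compares m with C times the energy, which
  never exceeds its initial value.\<close>

lemma mean_pressure_bounds:
  assumes t: "t \<in> {0..\<tau>}"
  shows "- C \<le> m t" and "m t \<le> C * (\<integral>y. P (\<rho> y) \<partial>M)"
proof -
  obtain L where L: "0 < L" "\<And>t x. t \<in> {0..\<tau>} \<Longrightarrow> x \<in> {0..R0} \<Longrightarrow> \<bar>p (x * exp (- u t x))\<bar> \<le> L"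
    "\<And>t x. t \<in> {0..\<tau>} \<Longrightarrow> x \<in> {0..R0} \<Longrightarrow> \<bar>p (x * exp (- u t x)) * exp (u t x)\<bar> \<le> L"
    "\<And>t. t \<in> {0..\<tau>} \<Longrightarrow> \<bar>m t\<bar> \<le> L"
    "\<And>t x. t \<in> {0..\<tau>} \<Longrightarrow> x \<in> {0..R0} \<Longrightarrow> exp (u t x) \<le> L"
    using p_eta_bounds by blast
  have i1: "integrable M (\<lambda>y. p (\<rho> y * exp (- u t (\<rho> y))) * exp (u t (\<rho> y)))"
    using L(3)[OF t \<rho>_range] p_eta_measurable[OF t] u_meas[OF t] by (intro integrable_const_bound[of _ L]) auto
  have i2: "integrable M (\<lambda>y. exp (u t (\<rho> y)))"
    using L(5)[OF t \<rho>_range] u_meas[OF t] by (intro integrable_const_bound[of _ L]) auto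
  have "- C = (\<integral>y. - C * exp (u t (\<rho> y)) \<partial>M)" by (simp add: mass_conserved[OF t])
  also have "\<dots> \<le> m t" unfolding m[OF t]
    using i1 i2 p_lower[OF eta_nonneg[OF \<rho>_range]] by (intro integral_mono mult_right_mono) auto
  finally show "- C \<le> m t" .
  have "m t \<le> (\<integral>y. C * (P (\<rho> y * exp (- u t (\<rho> y))) * exp (u t (\<rho> y))) \<partial>M)"
    unfolding m[OF t]
  proof (intro integral_mono i1 integrable_mult_right energy_decreasing(2)[OF t])
    fix y
    show "p (\<rho> y * exp (- u t (\<rho> y))) * exp (u t (\<rho> y)) \<le> C * (P (\<rho> y * exp (- u t (\<rho> y))) * exp (u t (\<rho> y)))"
      using mult_right_mono[OF p_le_P[OF eta_nonneg[OF \<rho>_range[of y], of t]], of "exp (u t (\<rho> y))"]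
      by (simp add: mult.assoc)
  qed
  also have "\<dots> \<le> C * (\<integral>y. P (\<rho> y) \<partial>M)"
    using energy_decreasing(1)[OF t] C_pos by simp
  finally show "m t \<le> C * (\<integral>y. P (\<rho> y) \<partial>M)" .
qed

text \<open>On contact \<eta> = r the derivative is -r (p(r) - m), negative since m \<le> C E(0) <
  p(r). The pressure is evaluated at the single density r, so it need not be monotone.\<close>

lemma eta_le_barrier:
  assumes r: "R0 \<le> r" "0 < r" "C * (\<integral>y. P (\<rho> y) \<partial>M) < p r"
    and t: "t \<in> {0..\<tau>}" and x: "x \<in> {0..R0}"
  shows "x * exp (- u t x) \<le> r"
proof (rule barrier_not_crossed[of 0 \<tau> "\<lambda>t. x * exp (- u t x)", OF _ _ _ t])
  have d: "((\<lambda>t. x * exp (- u t x)) has_real_derivative - (x * exp (- u t x)) * (p (x * exp (- u t x)) - m t)) (at t within {0..\<tau>})"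
    if "t \<in> {0..\<tau>}" for t using u_der[OF that x] by (auto intro!: derivative_eq_intros simp: algebra_simps)
  then show "continuous_on {0..\<tau>} (\<lambda>t. x * exp (- u t x))" by (rule DERIV_continuous_on)
  show "x * exp (- u 0 x) \<le> r" using x r u_0[OF x] by auto
  fix t assume t: "t \<in> {0..\<tau>}" and "x * exp (- u t x) = r"
  then show "\<exists>l<0. ((\<lambda>t. x * exp (- u t x)) has_real_derivative l) (at t within {0..\<tau>})"
    using d[OF t] mean_pressure_bounds(2)[OF t] r
    by (intro exI[of _ "- r * (p r - m t)"]) (auto intro!: mult_pos_pos)
qed

text \<open>The barrier confines the density to [0,r], where |p| \<le> S, and |m| is at most C + |C
  E(0)|. The assumed bound \<open>B\<close> on u does not appear in the result, which makes the
  bootstrap in \<open>flow_exists\<close> possible.\<close>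

lemma displacement_bound:
  assumes r: "R0 \<le> r" "0 < r" "C * (\<integral>y. P (\<rho> y) \<partial>M) < p r"
    and S: "\<And>x. x \<in> {0..r} \<Longrightarrow> \<bar>p x\<bar> \<le> S"
    and t: "t \<in> {0..\<tau>}" and x: "x \<in> {0..R0}"
  shows "\<bar>u t x\<bar> \<le> (S + C + \<bar>C * (\<integral>y. P (\<rho> y) \<partial>M)\<bar>) * t"
proof -
  have "\<bar>u t x - u 0 x\<bar> \<le> (S + C + \<bar>C * (\<integral>y. P (\<rho> y) \<partial>M)\<bar>) * \<bar>t - 0\<bar>"
    unfolding real_norm_def[symmetric]
  proof (rule field_differentiable_bound[of "{0..\<tau>}"])
    fix s assume s: "s \<in> {0..\<tau>}"
    show "((\<lambda>t. u t x) has_real_derivative p (x * exp (- u s x)) - m s) (at s within {0..\<tau>})"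
      by (rule u_der[OF s x])
    show "norm (p (x * exp (- u s x)) - m s) \<le> S + C + norm (C * (\<integral>y. P (\<rho> y) \<partial>M))"
      using S[of "x * exp (- u s x)"] eta_le_barrier[OF r s x] mean_pressure_bounds[OF s] eta_nonneg[OF x, of s] C_pos
      by auto
  qed (use t in auto)
  then show ?thesis using u_0[OF x] t by simp
qed

end

theorem flow_exists:
  obtains r where "\<And>T. 0 < T \<Longrightarrow> \<exists>u :: real \<Rightarrow> real \<Rightarrow>\<^sub>C real. continuous_on {0..T} u \<and> u 0 = 0 \<and>
    (\<forall>t\<in>{0..T}. \<forall>x\<in>{0..R0}. x * exp (- apply_bcontfun (u t) x) \<le> r \<and>
      ((\<lambda>t. apply_bcontfun (u t) x) has_real_derivative p (x * exp (- apply_bcontfun (u t) x))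
        - (\<integral>y. p (\<rho> y * exp (- apply_bcontfun (u t) (\<rho> y))) * exp (apply_bcontfun (u t) (\<rho> y)) \<partial>M))
        (at t within {0..T}))"
proof -
  define K where "K = C * (\<integral>y. P (\<rho> y) \<partial>M)"
  have bddp: "\<exists>S>0. \<forall>x\<in>{0..b}. \<bar>p x\<bar> \<le> S" for b
  proof -
    have "compact (p ` {0..b})"
      by (intro compact_continuous_image continuous_on_subset[OF p_cont]) auto
    then show ?thesis using compact_imp_bounded bounded_pos by (metis imageI real_norm_def)
  qed
  \<comment> \<open>Unboundedness provides some r with large p(r) but says nothing about the size of
    r. Asking for p(r) > S0 as well forces r > max R0 1, as p is at most S0 up to that
    point.\<close>
  obtain S0 where S0: "\<And>x. x \<in> {0..max R0 1} \<Longrightarrow> \<bar>p x\<bar> \<le> S0" using bddp by blast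
  obtain r where r0: "0 \<le> r" "max K S0 < p r" using p_unbounded by blast
  then have "\<not> r \<le> max R0 1" using S0[of r] by auto
  then have r: "R0 \<le> r" "0 < r" "K < p r" using r0 by auto
  obtain S1 where S1: "S1 > 0" "\<And>x. x \<in> {0..r} \<Longrightarrow> \<bar>p x\<bar> \<le> S1" using bddp by blast
  define S where "S = S1 + C + \<bar>K\<bar>"
  have S: "0 < S" using S1(1) C_pos by (simp add: S_def)
  show ?thesis
  proof (rule that[of r])
    fix T :: real assume T: "0 < T"
    \<comment> \<open>The bound S t is independent of the truncation level B, so the truncated flow never leaves
      the region where the truncation is inactive.\<close>
    define B where "B = S * T + 1"
    define c where "c z = max (- B) (min B z)" for z
    have B: "0 < B" using S T by (simp add: B_def add_pos_pos)
    have c: "\<bar>z\<bar> \<le> B \<Longrightarrow> c z = z" for z by (auto simp: c_def)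
    obtain u :: "real \<Rightarrow> real \<Rightarrow>\<^sub>C real" where u: "continuous_on {0..T} u" "u 0 = 0"
      "\<And>t x. t \<in> {0..T} \<Longrightarrow> x \<in> {0..R0} \<Longrightarrow> ((\<lambda>t. apply_bcontfun (u t) x) has_real_derivative
       p (x * exp (- c (apply_bcontfun (u t) x)))
       - (\<integral>y. p (\<rho> y * exp (- c (apply_bcontfun (u t) (\<rho> y)))) * exp (c (apply_bcontfun (u t) (\<rho> y))) \<partial>M))
       (at t within {0..T})"
      using truncated_flow_exists[OF B, of T] T unfolding c_def by auto
    define m where "m t = (\<integral>y. p (\<rho> y * exp (- apply_bcontfun (u t) (\<rho> y))) * exp (apply_bcontfun (u t) (\<rho> y)) \<partial>M)" for t
    have der: "((\<lambda>t. apply_bcontfun (u t) x) has_real_derivative p (x * exp (- apply_bcontfun (u t) x)) - m t) (at t within {0..\<tau>})"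
      if "\<tau> \<le> T" "\<And>t x. t \<in> {0..\<tau>} \<Longrightarrow> x \<in> {0..R0} \<Longrightarrow> \<bar>apply_bcontfun (u t) x\<bar> \<le> B" "t \<in> {0..\<tau>}" "x \<in> {0..R0}"
      for \<tau> t x
      using DERIV_subset[OF u(3)[of t x], of "{0..\<tau>}"] that \<rho>_range by (simp add: c m_def)
    have step: "\<bar>apply_bcontfun (u t) x\<bar> \<le> S * t" "x * exp (- apply_bcontfun (u t) x) \<le> r"
      if "\<tau> \<le> T" "\<And>t x. t \<in> {0..\<tau>} \<Longrightarrow> x \<in> {0..R0} \<Longrightarrow> \<bar>apply_bcontfun (u t) x\<bar> \<le> B" "t \<in> {0..\<tau>}" "x \<in> {0..R0}"
      for \<tau> t x
      using displacement_bound[of "\<lambda>t. apply_bcontfun (u t)" \<tau> B m r S1 t x, OF _ that(2) _ _ der[OF that(1,2)]]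
        eta_le_barrier[of "\<lambda>t. apply_bcontfun (u t)" \<tau> B m r t x, OF _ that(2) _ _ der[OF that(1,2)]]
        r S1(2) that(3,4) u(2)
      by (auto simp: S_def K_def m_def)
    obtain d where d: "0 < d" "\<And>s t. s \<in> {0..T} \<Longrightarrow> t \<in> {0..T} \<Longrightarrow> \<bar>s - t\<bar> < d \<Longrightarrow> dist (u s) (u t) < 1"
      using compact_uniformly_continuous[OF u(1) compact_Icc] unfolding uniformly_continuous_on_def
      by (metis dist_real_def zero_less_one)
    \<comment> \<open>Induction over time steps of length d/2, short enough for the strict bound
      \<open>< d\<close>. If |u| \<le> B up to \<tau>, the a priori estimate improves this to S T =
      B - 1 at \<tau>, and the next step adds less than 1, so B is still respected.\<close>
    have bound: "\<forall>t\<in>{0..T}. t \<le> real n * (d / 2) \<longrightarrow> (\<forall>x\<in>{0..R0}. \<bar>apply_bcontfun (u t) x\<bar> \<le> B)" for n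
    proof (induction n)
      case 0
      then show ?case using u(2) B by auto
    next
      case (Suc n)
      show ?case
      proof (intro ballI impI)
        fix t x assume t: "t \<in> {0..T}" "t \<le> real (Suc n) * (d / 2)" and x: "x \<in> {0..R0}"
        define \<tau> where "\<tau> = max 0 (t - d / 2)"
        have \<tau>: "\<tau> \<in> {0..T}" "\<tau> \<le> real n * (d / 2)" "\<bar>t - \<tau>\<bar> < d"
          using t d(1) by (auto simp: \<tau>_def max_def field_simps)
        have "\<bar>apply_bcontfun (u \<tau>) x\<bar> \<le> S * \<tau>"
          using \<tau> Suc.IH by (intro step(1)[of \<tau>] x) auto
        also have "\<dots> \<le> S * T" using \<tau> S by simp
        finally have "\<bar>apply_bcontfun (u \<tau>) x\<bar> \<le> S * T" .
        moreover have "\<bar>apply_bcontfun (u t) x - apply_bcontfun (u \<tau>) x\<bar> < 1"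
          using d(2)[OF t(1) \<tau>(1,3)] dist_bounded[of "u t" x "u \<tau>"] by (simp add: dist_real_def)
        ultimately show "\<bar>apply_bcontfun (u t) x\<bar> \<le> B" unfolding B_def by linarith
      qed
    qed
    obtain n where "T / (d / 2) \<le> real n" using real_arch_simple by blast
    then have "T \<le> real n * (d / 2)" using d by (simp add: field_simps)
    then have "\<bar>apply_bcontfun (u t) x\<bar> \<le> B" if "t \<in> {0..T}" "x \<in> {0..R0}" for t x
      using bound[of n] that by auto
    then show "\<exists>u :: real \<Rightarrow> real \<Rightarrow>\<^sub>C real. continuous_on {0..T} u \<and> u 0 = 0 \<and>
      (\<forall>t\<in>{0..T}. \<forall>x\<in>{0..R0}. x * exp (- apply_bcontfun (u t) x) \<le> r \<and>
        ((\<lambda>t. apply_bcontfun (u t) x) has_real_derivative p (x * exp (- apply_bcontfun (u t) x))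
          - (\<integral>y. p (\<rho> y * exp (- apply_bcontfun (u t) (\<rho> y))) * exp (apply_bcontfun (u t) (\<rho> y)) \<partial>M))
          (at t within {0..T}))"
      using u(1,2) step(2)[OF order_refl] der[OF order_refl] unfolding m_def
      by (intro exI[of _ u]) auto
  qed
qed

end

section \<open>Uniqueness of the flow\<close>

text \<open>No continuity of f' is assumed: the gauge integral recovers f from every derivative, and
  boundedness of f' makes the integral absolutely convergent, hence equal to the Lebesgue
  integral.\<close>

lemma LINT_derivative:
  fixes f f' :: "real \<Rightarrow> real"
  assumes "0 \<le> t"
    and der: "\<And>s. s \<in> {0..t} \<Longrightarrow> (f has_real_derivative f' s) (at s within {0..t})"
    and bnd: "\<And>s. s \<in> {0..t} \<Longrightarrow> \<bar>f' s\<bar> \<le> B"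
  shows "(LINT s:{0..t}|lebesgue. f' s) = f t - f 0"
proof -
  have hi: "(f' has_integral (f t - f 0)) {0..t}"
    using assms by (intro fundamental_theorem_of_calculus) (auto simp: has_real_derivative_iff_has_vector_derivative)
  have "f' absolutely_integrable_on {0..t}"
    using bnd hi by (intro absolutely_integrable_integrable_bound[where g="\<lambda>_. B"]) auto
  then show ?thesis using hi by (simp add: set_lebesgue_integral_eq_integral integral_unique)
qed

text \<open>Difference quotients at s are at most c |y - s|, so the derivative vanishes at every
  point. This stands in for the product rule, which would hold only almost everywhere for primitives
  of a measurable function.\<close>

lemma constant_if_quadratic_increments:
  fixes f :: "real \<Rightarrow> real"
  assumes q: "\<And>s t. s \<in> {a..b} \<Longrightarrow> t \<in> {a..b} \<Longrightarrow> \<bar>f t - f s\<bar> \<le> c * (t - s)\<^sup>2"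
    and t: "t \<in> {a..b}"
  shows "f t = f a"
proof -
  have "(f has_real_derivative 0) (at s within {a..b})" if s: "s \<in> {a..b}" for s
    unfolding has_field_derivative_iff
  proof (rule tendsto_rabs_zero_cancel, rule tendsto_sandwich)
    show "eventually (\<lambda>y. 0 \<le> \<bar>(f y - f s) / (y - s)\<bar>) (at s within {a..b})" by simp
    have "\<bar>(f y - f s) / (y - s)\<bar> \<le> c * \<bar>y - s\<bar>" if "y \<in> {a..b}" "y \<noteq> s" for y
      using q[OF s that(1)] that(2)
      by (auto simp: abs_divide divide_le_eq power2_eq_square mult.assoc)
    then show "eventually (\<lambda>y. \<bar>(f y - f s) / (y - s)\<bar> \<le> c * \<bar>y - s\<bar>) (at s within {a..b})"
      by (auto simp: eventually_at_filter)
    show "((\<lambda>y. c * \<bar>y - s\<bar>) \<longlongrightarrow> 0) (at s within {a..b})"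
      by (auto intro!: tendsto_eq_intros)
  qed auto
  then obtain k where "\<And>s. s \<in> {a..b} \<Longrightarrow> f s = k"
    using has_field_derivative_zero_constant[of "{a..b}" f] by auto
  then show ?thesis using t by (metis atLeastAtMost_iff order_refl order_trans)
qed

text \<open>Mean value theorem for z \<mapsto> exp z - exp x * z, whose derivative on the segment is
  at most exp B * |y - x|.\<close>

lemma exp_second_order_remainder:
  fixes x y B :: real
  assumes "x \<le> B" "y \<le> B"
  shows "\<bar>exp y - exp x - exp x * (y - x)\<bar> \<le> exp B * (y - x)\<^sup>2"
proof -
  have "\<bar>(exp y - exp x * y) - (exp x - exp x * x)\<bar> \<le> (exp B * \<bar>y - x\<bar>) * \<bar>y - x\<bar>"
    unfolding real_norm_def[symmetric]
  proof (rule field_differentiable_bound[of "closed_segment x y"])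
    fix z assume "z \<in> closed_segment x y"
    then have z: "z \<in> {min x y..max x y}" by (auto simp: closed_segment_eq_real_ivl split: if_splits)
    show "((\<lambda>z. exp z - exp x * z) has_real_derivative (exp z - exp x)) (at z within closed_segment x y)"
      by (auto intro!: derivative_eq_intros)
    have "\<bar>exp z - exp x\<bar> \<le> exp B * \<bar>z - x\<bar>" using z assms by (intro exp_lipschitz_on) auto
    also have "\<dots> \<le> exp B * \<bar>y - x\<bar>" using z by (intro mult_left_mono) auto
    finally show "norm (exp z - exp x) \<le> exp B * norm (y - x)" by simp
  qed auto
  then show ?thesis by (simp add: algebra_simps power2_eq_square)
qed

lemma integral_diff_initial:
  fixes f :: "real \<Rightarrow> real"
  assumes "f integrable_on {0..T}" "0 \<le> s" "s \<le> t" "t \<le> T"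
  shows "integral {0..t} f - integral {0..s} f = integral {s..t} f"
  using Henstock_Kurzweil_Integration.integral_combine[of 0 s t f] assms
    integrable_on_subinterval[OF assms(1), of 0 t] by auto

lemma abs_integral_le_const:
  fixes f :: "real \<Rightarrow> real"
  assumes "f integrable_on {s..t}" "s \<le> t" "\<And>r. r \<in> {s..t} \<Longrightarrow> \<bar>f r\<bar> \<le> B"
  shows "\<bar>integral {s..t} f\<bar> \<le> B * (t - s)"
proof -
  have "norm (integral {s..t} f) \<le> integral {s..t} (\<lambda>_. B)"
    using assms by (intro integral_norm_bound_integral) auto
  then show ?thesis using assms(2) by (simp add: mult.commute)
qed

text \<open>The coefficient is merely measurable, so neither N nor the primitive U of \<sigma> need be differentiable
  everywhere; but the increments of N exp U are of second order.\<close>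

lemma linear_integral_equation_exp:
  fixes N \<sigma> :: "real \<Rightarrow> real"
  assumes \<sigma>: "\<sigma> integrable_on {0..T}" "\<And>s. s \<in> {0..T} \<Longrightarrow> \<bar>\<sigma> s\<bar> \<le> B"
    and N\<sigma>: "(\<lambda>s. N s * \<sigma> s) integrable_on {0..T}"
    and N: "\<And>t. t \<in> {0..T} \<Longrightarrow> N t = a - integral {0..t} (\<lambda>s. N s * \<sigma> s)"
    and t: "t \<in> {0..T}"
  shows "N t = a * exp (- integral {0..t} \<sigma>)"
proof -
  define U where "U t = integral {0..t} \<sigma>" for t
  have B: "0 \<le> B" using \<sigma>(2)[OF t] by auto
  have "continuous_on {0..T} (\<lambda>t. a - integral {0..t} (\<lambda>s. N s * \<sigma> s))"
    by (intro continuous_intros indefinite_integral_continuous_1 N\<sigma>)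
  then have Nc: "continuous_on {0..T} N"
    by (rule continuous_on_eq) (use N in auto)
  then have "compact (N ` {0..T})" by (intro compact_continuous_image) auto
  then obtain K where K: "0 < K" "\<And>t. t \<in> {0..T} \<Longrightarrow> \<bar>N t\<bar> \<le> K"
    using compact_imp_bounded bounded_pos by (metis imageI real_norm_def)
  have sub: "f integrable_on {s..t}" if "f integrable_on {0..T}" "0 \<le> s" "t \<le> T" for f :: "real \<Rightarrow> real" and s t
    using that by (intro integrable_on_subinterval[OF that(1)]) auto
  have U: "U t - U s = integral {s..t} \<sigma>" "\<bar>U t - U s\<bar> \<le> B * (t - s)" if "0 \<le> s" "s \<le> t" "t \<le> T" for s t
  proof -
    show "U t - U s = integral {s..t} \<sigma>"
      unfolding U_def using that by (intro integral_diff_initial[OF \<sigma>(1)])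
    then show "\<bar>U t - U s\<bar> \<le> B * (t - s)"
      using that \<sigma> sub by (auto intro!: abs_integral_le_const)
  qed
  have U0: "U 0 = 0" by (simp add: U_def)
  have Ub: "U t \<le> B * T" if "t \<in> {0..T}" for t
  proof -
    have "\<bar>U t\<bar> \<le> B * t" using U(2)[of 0 t] that U0 by auto
    also have "\<dots> \<le> B * T" using that B by (intro mult_left_mono) auto
    finally show ?thesis by auto
  qed
  have NN: "N t - N s = - integral {s..t} (\<lambda>r. N r * \<sigma> r)" if "0 \<le> s" "s \<le> t" "t \<le> T" for s t
    using integral_diff_initial[OF N\<sigma>, of s t] N[of s] N[of t] that by simp
  have NB: "\<bar>N r * \<sigma> r\<bar> \<le> K * B" if "r \<in> {0..T}" for r
    unfolding abs_mult using K(1) K(2)[OF that] \<sigma>(2)[OF that] by (intro mult_mono) auto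
  have Nl: "\<bar>N t - N s\<bar> \<le> K * B * (t - s)" if "0 \<le> s" "s \<le> t" "t \<le> T" for s t
  proof -
    have "\<bar>integral {s..t} (\<lambda>r. N r * \<sigma> r)\<bar> \<le> K * B * (t - s)"
      using that NB sub[OF N\<sigma>, of s t] by (intro abs_integral_le_const) auto
    then show ?thesis using NN[OF that] by simp
  qed
  \<comment> \<open>The increment of N is first replaced by that of the equation with N frozen at s.
    The error is the integral of (N r - N s) \<sigma> r, hence quadratic because N is
    Lipschitz.\<close>
  have N2: "\<bar>N t - N s + N s * (U t - U s)\<bar> \<le> K * B * B * (t - s)\<^sup>2" if st: "0 \<le> s" "s \<le> t" "t \<le> T" for s t
  proof -
    have i: "(\<lambda>r. N r * \<sigma> r) integrable_on {s..t}" "(\<lambda>r. N s * \<sigma> r) integrable_on {s..t}"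
      using sub[OF N\<sigma> st(1,3)] sub[OF \<sigma>(1) st(1,3)] by (auto intro: integrable_on_mult_right)
    have "N t - N s + N s * (U t - U s) = - integral {s..t} (\<lambda>r. N r * \<sigma> r - N s * \<sigma> r)"
      unfolding Henstock_Kurzweil_Integration.integral_diff[OF i] NN[OF st] U(1)[OF st] by simp
    moreover have "\<bar>integral {s..t} (\<lambda>r. N r * \<sigma> r - N s * \<sigma> r)\<bar> \<le> (K * B * (t - s) * B) * (t - s)"
    proof (rule abs_integral_le_const)
      fix r assume r: "r \<in> {s..t}"
      have "\<bar>N r - N s\<bar> \<le> K * B * (r - s)" using Nl[of s r] r st by auto
      also have "\<dots> \<le> K * B * (t - s)" using r K(1) B by (intro mult_left_mono) auto
      finally have "\<bar>N r - N s\<bar> * \<bar>\<sigma> r\<bar> \<le> K * B * (t - s) * B"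
        using \<sigma>(2)[of r] r st K(1) B by (intro mult_mono) auto
      then show "\<bar>N r * \<sigma> r - N s * \<sigma> r\<bar> \<le> K * B * (t - s) * B"
        by (simp add: abs_mult flip: left_diff_distrib)
    qed (use i st in \<open>auto intro: integrable_diff\<close>)
    ultimately show ?thesis by (simp add: power2_eq_square algebra_simps)
  qed
  \<comment> \<open>The increment of N exp U splits into three quadratic terms: the Taylor remainder
    of exp, the product of the increments of U and N, and the remainder from \<open>N2\<close>. Each
    is at most K B^2 exp(B T) (t - s)^2, whence the factor 3.\<close>
  define c where "c = 3 * (K * B * B * exp (B * T))"
  have inc: "\<bar>N t * exp (U t) - N s * exp (U s)\<bar> \<le> c * (t - s)\<^sup>2" if st: "0 \<le> s" "s \<le> t" "t \<le> T" for s t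
  proof -
    have eq: "N t * exp (U t) - N s * exp (U s) = N t * (exp (U t) - exp (U s) - exp (U s) * (U t - U s))
      + exp (U s) * ((U t - U s) * (N t - N s)) + exp (U s) * (N t - N s + N s * (U t - U s))"
      by (simp add: algebra_simps)
    have e: "exp (U s) \<le> exp (B * T)" using Ub[of s] st by simp
    have "\<bar>exp (U t) - exp (U s) - exp (U s) * (U t - U s)\<bar> \<le> exp (B * T) * (U t - U s)\<^sup>2"
      using st by (intro exp_second_order_remainder Ub) auto
    also have "\<dots> \<le> exp (B * T) * (B * (t - s))\<^sup>2"
      using U(2)[OF st] by (intro mult_left_mono) (auto simp: abs_le_square_iff[symmetric])
    finally have "\<bar>N t\<bar> * \<bar>exp (U t) - exp (U s) - exp (U s) * (U t - U s)\<bar> \<le> K * (exp (B * T) * (B * (t - s))\<^sup>2)"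
      using K(2)[of t] K(1) st by (intro mult_mono) auto
    moreover have "exp (U s) * (\<bar>U t - U s\<bar> * \<bar>N t - N s\<bar>) \<le> exp (B * T) * ((B * (t - s)) * (K * B * (t - s)))"
      by (intro mult_mono e U(2)[OF st] Nl[OF st]) (use B st in auto)
    moreover have "exp (U s) * \<bar>N t - N s + N s * (U t - U s)\<bar> \<le> exp (B * T) * (K * B * B * (t - s)\<^sup>2)"
      by (intro mult_mono e N2[OF st]) auto
    moreover have "\<bar>x + y + z\<bar> \<le> \<bar>x\<bar> + \<bar>y\<bar> + \<bar>z\<bar>" for x y z :: real by simp
    note this[of "N t * (exp (U t) - exp (U s) - exp (U s) * (U t - U s))"
      "exp (U s) * ((U t - U s) * (N t - N s))" "exp (U s) * (N t - N s + N s * (U t - U s))",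
      folded eq, unfolded abs_mult abs_exp_cancel]
    ultimately have "\<bar>N t * exp (U t) - N s * exp (U s)\<bar> \<le> K * (exp (B * T) * (B * (t - s))\<^sup>2)
      + exp (B * T) * ((B * (t - s)) * (K * B * (t - s))) + exp (B * T) * (K * B * B * (t - s)\<^sup>2)"
      by linarith
    also have "\<dots> = c * (t - s)\<^sup>2"
    proof -
      have "K * (e * (B * h)\<^sup>2) + e * ((B * h) * (K * B * h)) + e * (K * B * B * h\<^sup>2)
        = 3 * (K * B * B * e) * h\<^sup>2" for e h by algebra
      then show ?thesis unfolding c_def .
    qed
    finally show ?thesis .
  qed
  have "N t * exp (U t) = N 0 * exp (U 0)"
  proof (rule constant_if_quadratic_increments[of 0 T "\<lambda>t. N t * exp (U t)" c, OF _ t])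
    fix s t assume "s \<in> {0..T}" "t \<in> {0..T}"
    then show "\<bar>N t * exp (U t) - N s * exp (U s)\<bar> \<le> c * (t - s)\<^sup>2"
      using inc[of s t] inc[of t s] by (cases "s \<le> t") (auto simp: abs_minus_commute power2_commute)
  qed
  also have "\<dots> = a" using N[of 0] t U0 by simp
  finally show ?thesis by (simp add: U_def exp_minus field_simps)
qed

text \<open>The contraction estimate is iterated on almost-everywhere inequalities instead of being
  applied to an essential supremum. Each iteration halves the bound; intersecting countably many
  sets of full measure leaves a single null set in y, valid for all t and all n.\<close>

lemma (in lagrangian_flow) flow_unique:
  fixes U V :: "real \<Rightarrow> 'a \<Rightarrow> real"
  defines "mean \<equiv> \<lambda>W s. \<integral>y. p (\<rho> y * exp (- W s y)) * exp (W s y) \<partial>M"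
  assumes meas: "\<And>W t. W \<in> {U, V} \<Longrightarrow> t \<in> {0..T} \<Longrightarrow> W t \<in> borel_measurable M"
    and bnd: "\<And>W t y. W \<in> {U, V} \<Longrightarrow> t \<in> {0..T} \<Longrightarrow> \<bar>W t y\<bar> \<le> B"
    and lip: "\<And>W s t y. W \<in> {U, V} \<Longrightarrow> s \<in> {0..T} \<Longrightarrow> t \<in> {0..T} \<Longrightarrow> \<bar>W t y - W s y\<bar> \<le> B * \<bar>t - s\<bar>"
    and eqn: "\<And>W. W \<in> {U, V} \<Longrightarrow> AE y in M. \<forall>t\<in>{0..T}.
      W t y = integral {0..t} (\<lambda>s. p (\<rho> y * exp (- W s y)) - mean W s)"
  shows "AE y in M. \<forall>t\<in>{0..T}. U t y = V t y"
proof (cases "0 \<le> T")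
  case T: True
  have B: "0 \<le> B" using bnd[of U 0 undefined] T by auto
  obtain L where L: "0 < L"
    "\<And>x z z'. x \<in> {0..R0} \<Longrightarrow> \<bar>z\<bar> \<le> B \<Longrightarrow> \<bar>z'\<bar> \<le> B \<Longrightarrow>
      \<bar>p (x * exp (- z)) - p (x * exp (- z'))\<bar> \<le> L * \<bar>z - z'\<bar>"
    "\<And>x z z'. x \<in> {0..R0} \<Longrightarrow> \<bar>z\<bar> \<le> B \<Longrightarrow> \<bar>z'\<bar> \<le> B \<Longrightarrow>
      \<bar>p (x * exp (- z)) * exp z - p (x * exp (- z')) * exp z'\<bar> \<le> L * \<bar>z - z'\<bar>"
    "\<And>x z. x \<in> {0..R0} \<Longrightarrow> \<bar>z\<bar> \<le> B \<Longrightarrow> \<bar>p (x * exp (- z))\<bar> \<le> L"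
    "\<And>x z. x \<in> {0..R0} \<Longrightarrow> \<bar>z\<bar> \<le> B \<Longrightarrow> \<bar>p (x * exp (- z)) * exp z\<bar> \<le> L"
    using pressure_exp_lipschitz[of B] by blast
  have int: "integrable M (\<lambda>y. p (\<rho> y * exp (- W t y)) * exp (W t y))" if "W \<in> {U, V}" "t \<in> {0..T}" for W t
    using \<rho>_nonneg L(5)[OF \<rho>_range bnd[OF that]] meas[OF that]
    by (intro integrable_const_bound[of _ L] borel_measurable_times continuous_nonneg_comp_measurable[OF p_cont])
       auto
  have cF: "continuous_on {0..T} (\<lambda>s. p (\<rho> y * exp (- W s y)) - mean W s)" if W: "W \<in> {U, V}" for W y
  proof (intro continuous_intros)
    have "\<bar>p (\<rho> y * exp (- W t y)) - p (\<rho> y * exp (- W s y))\<bar> \<le> (L * B) * \<bar>t - s\<bar>"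
      if "s \<in> {0..T}" "t \<in> {0..T}" for s t
      using order_trans[OF L(2)[OF \<rho>_range bnd[OF W that(2)] bnd[OF W that(1)]] mult_left_mono[OF lip[OF W that]]] L(1)
      by (simp add: mult.assoc)
    then show "continuous_on {0..T} (\<lambda>s. p (\<rho> y * exp (- W s y)))"
      using L(1) B by (intro lipschitz_on_continuous_on[of "L * B"] lipschitz_onI) (auto simp: dist_real_def)
    have "\<bar>mean W t - mean W s\<bar> \<le> (L * B) * \<bar>t - s\<bar>" if "s \<in> {0..T}" "t \<in> {0..T}" for s t
      unfolding mean_def
    proof (intro expectation_diff_le int W that AE_I2)
      fix y
      show "\<bar>p (\<rho> y * exp (- W t y)) * exp (W t y) - p (\<rho> y * exp (- W s y)) * exp (W s y)\<bar> \<le> L * B * \<bar>t - s\<bar>"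
        using order_trans[OF L(3)[OF \<rho>_range bnd[OF W that(2)] bnd[OF W that(1)]] mult_left_mono[OF lip[OF W that]]] L(1)
        by (simp add: mult.assoc)
    qed
    then show "continuous_on {0..T} (mean W)"
      using L(1) B by (intro lipschitz_on_continuous_on[of "L * B"] lipschitz_onI) (auto simp: dist_real_def)
  qed
  \<comment> \<open>The start is the crude bound 2 B, as both displacements are bounded by B. The
    rate is 2 L because the local term and the mean contribute L each; the weight is exp of twice
    that rate.\<close>
  have halve: "AE y in M. \<forall>t\<in>{0..T}. \<bar>U t y - V t y\<bar> \<le> (2 * B * (1/2)^n) * exp (2 * (2 * L) * t)" for n
  proof (induction n)
    case 0
    have "\<bar>U t y - V t y\<bar> \<le> (2 * B * (1/2)^0) * exp (2 * (2 * L) * t)" if t: "t \<in> {0..T}" for t y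
    proof -
      have "\<bar>U t y - V t y\<bar> \<le> 2 * B * 1" using bnd[of U t y] bnd[of V t y] t by auto
      also have "\<dots> \<le> 2 * B * exp (2 * (2 * L) * t)" using B L(1) t by (intro mult_left_mono) auto
      finally show ?thesis by simp
    qed
    then show ?case by auto
  next
    case (Suc n)
    define K where "K = 2 * B * (1/2)^n"
    have K: "0 \<le> K" using B by (simp add: K_def)
    have IH: "AE y in M. \<forall>t\<in>{0..T}. \<bar>U t y - V t y\<bar> \<le> K * exp (2 * (2 * L) * t)"
      using Suc unfolding K_def .
    have mm: "\<bar>mean U s - mean V s\<bar> \<le> L * (K * exp (2 * (2 * L) * s))" if s: "s \<in> {0..T}" for s
      unfolding mean_def
    proof (rule expectation_diff_le)
      show "AE y in M. \<bar>p (\<rho> y * exp (- U s y)) * exp (U s y) - p (\<rho> y * exp (- V s y)) * exp (V s y)\<bar>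
         \<le> L * (K * exp (2 * (2 * L) * s))"
        using IH
      proof eventually_elim
        case (elim y)
        have "\<bar>p (\<rho> y * exp (- U s y)) * exp (U s y) - p (\<rho> y * exp (- V s y)) * exp (V s y)\<bar> \<le> L * \<bar>U s y - V s y\<bar>"
          using bnd s by (intro L(3) \<rho>_range) auto
        also have "\<dots> \<le> L * (K * exp (2 * (2 * L) * s))" using elim s L(1) by (intro mult_left_mono) auto
        finally show ?case .
      qed
    qed (use int s in auto)
    show ?case using IH eqn[OF insertI1] eqn[OF insertI2[OF singletonI]]
    proof eventually_elim
      case (elim y)
      show ?case
      proof
        fix t assume t: "t \<in> {0..T}"
        let ?f = "\<lambda>W s. p (\<rho> y * exp (- W s y)) - mean W s"
        have i: "?f W integrable_on {0..t}" if "W \<in> {U, V}" for W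
          by (rule integrable_continuous_real[OF continuous_on_subset[OF cF[OF that]]]) (use t in auto)
        have "U t y - V t y = integral {0..t} (?f U) - integral {0..t} (?f V)"
          using elim(2)[rule_format, OF t] elim(3)[rule_format, OF t] by (simp only:)
        also have "\<dots> = integral {0..t} (\<lambda>s. ?f U s - ?f V s)"
          by (intro Henstock_Kurzweil_Integration.integral_diff[symmetric] i) auto
        finally have eq: "U t y - V t y = integral {0..t} (\<lambda>s. ?f U s - ?f V s)" .
        have "\<bar>U t y - V t y\<bar> \<le> integral {0..t} (\<lambda>s. K * ((2 * L) * exp (2 * (2 * L) * s)))"
          unfolding real_norm_def[symmetric] eq
        proof (rule integral_norm_bound_integral)
          show "(\<lambda>s. ?f U s - ?f V s) integrable_on {0..t}" by (rule integrable_diff; rule i; simp)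
          show "(\<lambda>s. K * ((2 * L) * exp (2 * (2 * L) * s))) integrable_on {0..t}"
            by (intro integrable_continuous_real continuous_intros)
          fix s assume "s \<in> {0..t}"
          then have s: "s \<in> {0..T}" using t by auto
          have "\<bar>p (\<rho> y * exp (- U s y)) - p (\<rho> y * exp (- V s y))\<bar> \<le> L * \<bar>U s y - V s y\<bar>"
            using bnd s by (intro L(2) \<rho>_range) auto
          also have "\<dots> \<le> L * (K * exp (2 * (2 * L) * s))" using elim(1) s L(1) by (intro mult_left_mono) auto
          finally show "norm (?f U s - ?f V s) \<le> K * ((2 * L) * exp (2 * (2 * L) * s))"
            using mm[OF s] by (simp add: algebra_simps)
        qed
        also have "\<dots> = K * ((exp (2 * (2 * L) * t) - 1) / 2)"
          using has_integral_mult_right[OF has_integral_exp_double_rate[of t "2 * L"], of K] t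
          by (intro integral_unique) auto
        also have "\<dots> \<le> K * (exp (2 * (2 * L) * t) / 2)" using K by (intro mult_left_mono) auto
        finally show "\<bar>U t y - V t y\<bar> \<le> 2 * B * (1 / 2) ^ Suc n * exp (2 * (2 * L) * t)"
          by (simp add: K_def)
      qed
    qed
  qed
  then have "AE y in M. \<forall>n. \<forall>t\<in>{0..T}. \<bar>U t y - V t y\<bar> \<le> (2 * B * (1/2)^n) * exp (2 * (2 * L) * t)"
    by (subst AE_all_countable) blast
  then show ?thesis
  proof eventually_elim
    case (elim y)
    show ?case
    proof
      fix t assume t: "t \<in> {0..T}"
      have "(\<lambda>n. (2 * B * (1/2)^n) * exp (2 * (2 * L) * t)) \<longlonglongrightarrow> (2 * B * 0) * exp (2 * (2 * L) * t)"
        by (intro tendsto_intros LIMSEQ_realpow_zero) auto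
      then have "\<bar>U t y - V t y\<bar> \<le> (2 * B * 0) * exp (2 * (2 * L) * t)"
        by (rule LIMSEQ_le_const) (use elim t in auto)
      then show "U t y = V t y" by simp
    qed
  qed
qed auto

section \<open>Almost everywhere statements on products and on the torus\<close>

text \<open>Q is arbitrary; enclosing its exceptional set in a Borel null set supplies the
  measurability needed to exchange the order of the two quantifiers.\<close>

lemma AE_lborel_pairD:
  fixes Q :: "'a::euclidean_space \<times> 'b::euclidean_space \<Rightarrow> bool"
  assumes "AE z in lborel. Q z"
  shows "AE x in lborel. AE y in lborel. Q (x, y)" "AE y in lborel. AE x in lborel. Q (x, y)"
proof -
  obtain N where N: "N \<in> null_sets lborel" "{z. \<not> Q z} \<subseteq> N"
    using assms unfolding eventually_ae_filter by auto
  have "AE z in lborel \<Otimes>\<^sub>M lborel. z \<notin> N"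
    unfolding lborel_prod using N(1) by (rule AE_not_in)
  then have *: "AE x in lborel. AE y in lborel. (x, y) \<notin> N"
    by (rule lborel_pair.AE_pair)
  have "N \<in> sets lborel" using N(1) by blast
  then have "{z \<in> space (lborel \<Otimes>\<^sub>M lborel). (fst z, snd z) \<notin> N} \<in> sets (lborel \<Otimes>\<^sub>M lborel)"
    unfolding lborel_prod by (auto simp: Compl_eq[symmetric])
  then have **: "AE y in lborel. AE x in lborel. (x, y) \<notin> N"
    using lborel_pair.AE_commute[of "\<lambda>x y. (x, y) \<notin> N"] * by blast
  show "AE x in lborel. AE y in lborel. Q (x, y)" using * N(2) by (auto elim!: eventually_mono)
  show "AE y in lborel. AE x in lborel. Q (x, y)" using ** N(2) by (auto elim!: eventually_mono)
qed

text \<open>This is the Tonelli direction, from null sections to a null set, and the measurability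
  of the set where Q holds is what permits it.\<close>

lemma AE_lborel_pairI:
  fixes Q :: "'a::euclidean_space \<times> 'b::euclidean_space \<Rightarrow> bool"
  assumes meas: "{z. Q z} \<in> sets borel" and "AE y in lborel. AE x in lborel. Q (x, y)"
  shows "AE z in lborel. Q z"
proof -
  have s: "{z \<in> space (lborel \<Otimes>\<^sub>M lborel). Q (fst z, snd z)} \<in> sets (lborel \<Otimes>\<^sub>M lborel)"
    unfolding lborel_prod using meas by simp
  then have "AE x in lborel. AE y in lborel. Q (x, y)"
    using lborel_pair.AE_commute[of "\<lambda>x y. Q (x, y)"] assms(2) by blast
  then have "AE z in lborel \<Otimes>\<^sub>M lborel. Q z"
    using s by (intro lborel_pair.AE_pair_measure) auto
  then show ?thesis unfolding lborel_prod .
qed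

lemma AE_lborel_fst_snd:
  fixes P :: "'a::euclidean_space \<Rightarrow> bool" and Q :: "'b::euclidean_space \<Rightarrow> bool"
  shows "AE x in lborel. P x \<Longrightarrow> AE z in (lborel :: ('a \<times> 'b) measure). P (fst z)"
    and "AE y in lborel. Q y \<Longrightarrow> AE z in (lborel :: ('a \<times> 'b) measure). Q (snd z)"
proof -
  assume "AE x in lborel. P x"
  then obtain N where N: "N \<in> null_sets lborel" "{x. \<not> P x} \<subseteq> N"
    unfolding eventually_ae_filter by auto
  have [measurable]: "N \<in> sets borel" using N(1) by auto
  have "AE z in (lborel :: ('a \<times> 'b) measure). fst z \<notin> N"
  proof (rule AE_lborel_pairI)
    have "fst -` (- N) \<inter> space borel \<in> sets (borel :: ('a \<times> 'b) measure)"
      by (rule measurable_sets[of _ borel borel])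
         (auto intro!: borel_measurable_continuous_onI continuous_intros)
    then show "{z :: 'a \<times> 'b. fst z \<notin> N} \<in> sets borel" by (simp add: vimage_def)
  qed (use AE_not_in[OF N(1)] in auto)
  then show "AE z in (lborel :: ('a \<times> 'b) measure). P (fst z)" using N(2) by (auto elim!: eventually_mono)
next
  assume "AE x in lborel. Q x"
  then obtain N where N: "N \<in> null_sets lborel" "{x. \<not> Q x} \<subseteq> N"
    unfolding eventually_ae_filter by auto
  have [measurable]: "N \<in> sets borel" using N(1) by auto
  have "AE z in (lborel :: ('a \<times> 'b) measure). snd z \<notin> N"
  proof (rule AE_lborel_pairI)
    have "snd -` (- N) \<inter> space borel \<in> sets (borel :: ('a \<times> 'b) measure)"
      by (rule measurable_sets[of _ borel borel])
         (auto intro!: borel_measurable_continuous_onI continuous_intros)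
    then show "{z :: 'a \<times> 'b. snd z \<notin> N} \<in> sets borel" by (simp add: vimage_def)
  qed (use AE_not_in[OF N(1)] in \<open>auto elim!: eventually_mono\<close>)
  then show "AE z in (lborel :: ('a \<times> 'b) measure). Q (snd z)" using N(2) by (auto elim!: eventually_mono)
qed

text \<open>Translates the time integrals of (L), taken of functions known only almost everywhere,
  into gauge integrals of a bounded Borel representative, for which additivity over intervals is at
  hand.\<close>

lemma LINT_bounded_borel:
  fixes f f' :: "real \<Rightarrow> real"
  assumes f: "f \<in> borel_measurable borel" "\<And>s. \<bar>f s\<bar> \<le> B"
  shows "f integrable_on {a..b}"
    and "AE s in lborel. s \<in> {a..b} \<longrightarrow> f' s = f s \<Longrightarrow> (LINT s:{a..b}|lebesgue. f' s) = integral {a..b} f"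
proof -
  have "f absolutely_integrable_on {a..b}"
  proof (rule measurable_bounded_by_integrable_imp_absolutely_integrable[where g="\<lambda>_. B"])
    show "f \<in> borel_measurable (lebesgue_on {a..b})"
      using f(1) by (intro measurable_restrict_space1 measurable_completion) simp
  qed (use f in auto)
  then have i: "f integrable_on {a..b}" and *: "(LINT s:{a..b}|lebesgue. f s) = integral {a..b} f"
    by (auto simp: set_lebesgue_integral_eq_integral)
  show "f integrable_on {a..b}" by (rule i)
  have fm: "(\<lambda>s. indicator {a..b} s *\<^sub>R f s) \<in> borel_measurable lebesgue"
    using f(1) by (intro measurable_completion) simp
  assume "AE s in lborel. s \<in> {a..b} \<longrightarrow> f' s = f s"
  then have ae: "AE s in lebesgue. indicator {a..b} s *\<^sub>R f s = indicator {a..b} s *\<^sub>R f' s"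
    unfolding AE_completion_iff by (auto simp: indicator_def elim!: eventually_mono)
  have "(LINT s:{a..b}|lebesgue. f' s) = (LINT s:{a..b}|lebesgue. f s)"
    unfolding set_lebesgue_integral_def
    by (intro integral_cong_AE fm borel_measurable_AE[OF fm ae]) (use ae in \<open>auto elim!: eventually_mono\<close>)
  then show "(LINT s:{a..b}|lebesgue. f' s) = integral {a..b} f" using * by simp
qed

text \<open>Clipping a Borel representative at the essential bound alters it on S only within a null
  set and makes the bound hold everywhere.\<close>

lemma Linfty_on_borel_representative:
  assumes "Linfty_on S f"
  obtains g B where "g \<in> borel_measurable borel" "\<And>x. \<bar>g x\<bar> \<le> B" "AE x in lborel. x \<in> S \<longrightarrow> f x = g x"
proof -
  obtain B where B: "AE x in lebesgue. x \<in> S \<longrightarrow> \<bar>f x\<bar> \<le> B"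
    and m: "(\<lambda>x. indicator S x *\<^sub>R f x) \<in> borel_measurable lebesgue"
    using assms unfolding Linfty_on_def set_borel_measurable_def by auto
  obtain g where g: "g \<in> borel_measurable lborel" "AE x in lborel. indicator S x *\<^sub>R f x = g x"
    using completion_ex_borel_measurable_real[OF m] by auto
  define h where "h x = max (- \<bar>B\<bar>) (min \<bar>B\<bar> (g x))" for x
  show ?thesis
  proof (rule that[of h "\<bar>B\<bar>"])
    show "h \<in> borel_measurable borel" using g(1) unfolding h_def by simp
    show "\<bar>h x\<bar> \<le> \<bar>B\<bar>" for x by (auto simp: h_def)
    show "AE x in lborel. x \<in> S \<longrightarrow> f x = h x"
      using g(2) B[unfolded AE_completion_iff]
      by eventually_elim (auto simp: h_def)
  qed
qed

lemma Linfty_on_if_borel: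
  assumes "f \<in> borel_measurable borel" "S \<in> sets borel" "\<And>x. x \<in> S \<Longrightarrow> \<bar>f x\<bar> \<le> B"
  shows "Linfty_on S f"
  unfolding Linfty_on_def set_borel_measurable_def
proof
  show "(\<lambda>x. indicator S x *\<^sub>R f x) \<in> borel_measurable lebesgue"
    using assms(1,2) by (intro measurable_completion) simp
  show "\<exists>B. AE x in lebesgue. x \<in> S \<longrightarrow> \<bar>f x\<bar> \<le> B" using assms(3) by (intro exI[of _ B]) auto
qed

section \<open>The torus as a probability space\<close>

lemma torus_borel [measurable]: "(torus :: (real^'d) set) \<in> sets borel"
  by (simp add: torus_def)

lemma emeasure_torus: "emeasure lborel (torus :: (real^'d) set) = 1"
  unfolding torus_def by (subst emeasure_lborel_cbox) (auto simp: inner_sum_left_Basis)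

abbreviation torus_measure :: "(real^'d) measure" where
  "torus_measure \<equiv> restrict_space lborel torus"

lemma prob_space_torus: "prob_space (torus_measure :: (real^'d) measure)"
  by (rule prob_spaceI) (simp add: emeasure_restrict_space emeasure_torus)

lemma measure_torus: "measure lebesgue (torus :: (real^'d) set) = 1"
  by (simp add: measure_def emeasure_torus)

lemma borel_measurable_torus_measure:
  "f \<in> borel_measurable borel \<Longrightarrow> f \<in> borel_measurable torus_measure"
  by (intro measurable_restrict_space1) simp

lemma AE_torus_measure_iff:
  "(AE y in (torus_measure :: (real^'d) measure). Q y) \<longleftrightarrow> (AE y in lborel. y \<in> torus \<longrightarrow> Q y)"
  by (rule AE_restrict_space_iff) simp

lemma LINT_torus:
  fixes f g :: "real^'d \<Rightarrow> real"
  assumes g: "g \<in> borel_measurable borel" and ae: "AE y in lborel. y \<in> torus \<longrightarrow> f y = g y"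
  shows "(LINT y:torus|lebesgue. f y) = (\<integral>y. g y \<partial>torus_measure)"
proof -
  have gm: "(\<lambda>y. indicator torus y *\<^sub>R g y) \<in> borel_measurable lborel"
    using g by simp
  then have gm': "(\<lambda>y. indicator torus y *\<^sub>R g y) \<in> borel_measurable lebesgue"
    by (rule measurable_completion)
  have ae': "AE y in lebesgue. indicator torus y *\<^sub>R g y = indicator torus y *\<^sub>R f y"
    using ae unfolding AE_completion_iff by (auto simp: indicator_def elim!: eventually_mono)
  have "(LINT y:torus|lebesgue. f y) = (LINT y:torus|lebesgue. g y)"
    unfolding set_lebesgue_integral_def
    by (intro integral_cong_AE gm' borel_measurable_AE[OF gm' ae']) (use ae' in \<open>auto elim!: eventually_mono\<close>)
  also have "\<dots> = (\<integral>y. g y \<partial>torus_measure)"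
    unfolding set_lebesgue_integral_def integral_completion[OF gm]
    by (rule integral_restrict_space[symmetric]) simp
  finally show ?thesis .
qed

section \<open>Solutions of (L) and flows\<close>

lemma (in lagrangian_flow) mean_flow_continuous:
  fixes v :: "real \<Rightarrow> real \<Rightarrow>\<^sub>C real"
  assumes v: "continuous_on UNIV v" and B: "\<And>t. norm (v t) \<le> B"
  shows "continuous_on UNIV (\<lambda>t. \<integral>y. p (\<rho> y * exp (- apply_bcontfun (v t) (\<rho> y))) * exp (apply_bcontfun (v t) (\<rho> y)) \<partial>M)"
    (is "continuous_on UNIV ?m")
proof -
  obtain L where L: "0 < L"
    "\<And>x z z'. x \<in> {0..R0} \<Longrightarrow> \<bar>z\<bar> \<le> B \<Longrightarrow> \<bar>z'\<bar> \<le> B \<Longrightarrow>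
      \<bar>p (x * exp (- z)) - p (x * exp (- z'))\<bar> \<le> L * \<bar>z - z'\<bar>"
    "\<And>x z z'. x \<in> {0..R0} \<Longrightarrow> \<bar>z\<bar> \<le> B \<Longrightarrow> \<bar>z'\<bar> \<le> B \<Longrightarrow>
      \<bar>p (x * exp (- z)) * exp z - p (x * exp (- z')) * exp z'\<bar> \<le> L * \<bar>z - z'\<bar>"
    "\<And>x z. x \<in> {0..R0} \<Longrightarrow> \<bar>z\<bar> \<le> B \<Longrightarrow> \<bar>p (x * exp (- z))\<bar> \<le> L"
    "\<And>x z. x \<in> {0..R0} \<Longrightarrow> \<bar>z\<bar> \<le> B \<Longrightarrow> \<bar>p (x * exp (- z)) * exp z\<bar> \<le> L"
    using pressure_exp_lipschitz[of B] by blast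
  have vb: "\<bar>apply_bcontfun (v t) x\<bar> \<le> B" for t x
    using norm_bounded[of "v t" x] B[of t] by simp
  have int: "integrable M (\<lambda>y. p (\<rho> y * exp (- apply_bcontfun (v t) (\<rho> y))) * exp (apply_bcontfun (v t) (\<rho> y)))" for t
    using \<rho>_nonneg L(5)[OF \<rho>_range vb]
    by (intro integrable_const_bound[of _ L] borel_measurable_times continuous_nonneg_comp_measurable[OF p_cont])
       auto
  have d: "\<bar>?m t - ?m s\<bar> \<le> L * norm (v t - v s)" for s t
  proof (intro expectation_diff_le int AE_I2)
    fix y
    have "\<bar>apply_bcontfun (v t) (\<rho> y) - apply_bcontfun (v s) (\<rho> y)\<bar> \<le> norm (v t - v s)"
      using norm_bounded[of "v t - v s" "\<rho> y"] by simp
    then show "\<bar>p (\<rho> y * exp (- apply_bcontfun (v t) (\<rho> y))) * exp (apply_bcontfun (v t) (\<rho> y)) -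
      p (\<rho> y * exp (- apply_bcontfun (v s) (\<rho> y))) * exp (apply_bcontfun (v s) (\<rho> y))\<bar> \<le> L * norm (v t - v s)"
      using L(1) by (intro order_trans[OF L(3)[OF \<rho>_range vb vb]] mult_left_mono) auto
  qed
  show ?thesis unfolding continuous_on_def
  proof (intro ballI)
    fix s
    have "((\<lambda>t. L * norm (v t - v s)) \<longlongrightarrow> L * norm (v s - v s)) (at s)"
      using v unfolding continuous_on_def by (intro tendsto_intros) auto
    then have "((\<lambda>t. L * norm (v t - v s)) \<longlongrightarrow> 0) (at s)" by simp
    then have "((\<lambda>t. ?m t - ?m s) \<longlongrightarrow> 0) (at s)"
      by (rule Lim_null_comparison[rotated]) (simp only: real_norm_def d eventually_True)
    then show "(?m \<longlongrightarrow> ?m s) (at s)" by (rule LIM_zero_cancel)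
  qed
qed

text \<open>The supremum norm controls the time variation uniformly in x, and each v(t) is
  continuous in x. Joint continuity is the source of the joint measurability of (t,y) \<mapsto>
  u(t)(\<open>\<rho> y\<close>).\<close>

lemma continuous_on_bcontfun_eval:
  fixes v :: "real \<Rightarrow> real \<Rightarrow>\<^sub>C real"
  assumes v: "continuous_on UNIV v"
  shows "continuous_on UNIV (\<lambda>z. apply_bcontfun (v (fst z)) (snd z))"
  unfolding continuous_on_def
proof (intro ballI)
  fix z0 :: "real \<times> real"
  have "((\<lambda>z. norm (v (fst z) - v (fst z0))) \<longlongrightarrow> norm (v (fst z0) - v (fst z0))) (at z0)"
  proof (intro tendsto_intros)
    have "continuous_on UNIV (\<lambda>z :: real \<times> real. v (fst z))"
      by (intro continuous_on_compose2[OF v] continuous_intros) auto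
    then show "((\<lambda>z. v (fst z)) \<longlongrightarrow> v (fst z0)) (at z0)" unfolding continuous_on_def by blast
  qed
  then have "((\<lambda>z. norm (v (fst z) - v (fst z0))) \<longlongrightarrow> 0) (at z0)" by simp
  then have "((\<lambda>z. apply_bcontfun (v (fst z) - v (fst z0)) (snd z)) \<longlongrightarrow> 0) (at z0)"
    by (rule Lim_null_comparison[rotated]) (simp only: norm_bounded eventually_True)
  moreover have "((\<lambda>z. apply_bcontfun (v (fst z0)) (snd z)) \<longlongrightarrow> apply_bcontfun (v (fst z0)) (snd z0)) (at z0)"
  proof -
    have "continuous_on UNIV (\<lambda>z :: real \<times> real. apply_bcontfun (v (fst z0)) (snd z))"
      by (intro continuous_on_compose2[OF continuous_on_apply_bcontfun[of UNIV]] continuous_intros) auto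
    then show ?thesis unfolding continuous_on_def by blast
  qed
  ultimately have "((\<lambda>z. apply_bcontfun (v (fst z) - v (fst z0)) (snd z) + apply_bcontfun (v (fst z0)) (snd z))
     \<longlongrightarrow> 0 + apply_bcontfun (v (fst z0)) (snd z0)) (at z0)"
    by (rule tendsto_add)
  then show "((\<lambda>z. apply_bcontfun (v (fst z)) (snd z)) \<longlongrightarrow> apply_bcontfun (v (fst z0)) (snd z0)) (at z0)"
    by simp
qed

text \<open>With \<eta> = \<rho> exp(-u) and \<sigma> = p(\<eta>) - m the equations hold for every t
  in [0,T] and every y once \<open>rho0\<close> is replaced by \<open>\<rho>\<close>. The only
  exceptional points lie over the null set where the two differ.\<close>

lemma solves_L_of_flow:
  fixes \<rho> rho0 :: "real^'d \<Rightarrow> real" and u :: "real \<Rightarrow> real \<Rightarrow>\<^sub>C real"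
  assumes flow: "lagrangian_flow torus_measure \<rho> R0 p D"
    and \<rho>: "\<rho> \<in> borel_measurable borel" "AE y in lborel. y \<in> torus \<longrightarrow> rho0 y = \<rho> y"
    and T: "0 < T" and uc: "continuous_on {0..T} u" and u0: "u 0 = 0"
    and der: "\<And>t x. t \<in> {0..T} \<Longrightarrow> x \<in> {0..R0} \<Longrightarrow>
      ((\<lambda>t. apply_bcontfun (u t) x) has_real_derivative p (x * exp (- apply_bcontfun (u t) x))
        - (\<integral>y. p (\<rho> y * exp (- apply_bcontfun (u t) (\<rho> y))) * exp (apply_bcontfun (u t) (\<rho> y)) \<partial>torus_measure))
        (at t within {0..T})"
  obtains \<eta> \<sigma> where "solves_L p rho0 T \<eta> \<sigma>"
    "\<And>t y. t \<in> {0..T} \<Longrightarrow> \<eta> t y = \<rho> y * exp (- apply_bcontfun (u t) (\<rho> y))"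
proof -
  interpret lagrangian_flow torus_measure \<rho> R0 p D by (rule flow)
  \<comment> \<open>Freezing time outside [0,T] turns u into a continuous function on the whole
    line, so that \<eta> and \<sigma> are Borel on the whole space-time.\<close>
  define cl where "cl t = max 0 (min T t)" for t :: real
  have cl: "cl t \<in> {0..T}" "t \<in> {0..T} \<Longrightarrow> cl t = t" for t using T by (auto simp: cl_def)
  define v where "v t = u (cl t)" for t
  have vu: "v t = u t" if "t \<in> {0..T}" for t using cl(2)[OF that] by (simp add: v_def)
  have vc: "continuous_on UNIV v"
    unfolding v_def
  proof (rule continuous_on_compose2[OF uc])
    show "continuous_on UNIV cl" unfolding cl_def by (intro continuous_intros)
  qed (use cl(1) in blast)
  have "compact (u ` {0..T})" by (intro compact_continuous_image uc) auto
  then obtain B where B: "\<And>t. t \<in> {0..T} \<Longrightarrow> norm (u t) \<le> B"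
    using compact_imp_bounded bounded_pos by (metis imageI)
  have vB: "norm (v t) \<le> B" for t unfolding v_def by (rule B[OF cl(1)])
  have vb: "\<bar>apply_bcontfun (v t) x\<bar> \<le> B" for t x
    using norm_bounded[of "v t" x] vB[of t] by simp
  obtain L where L: "0 < L"
    "\<And>x z z'. x \<in> {0..R0} \<Longrightarrow> \<bar>z\<bar> \<le> B \<Longrightarrow> \<bar>z'\<bar> \<le> B \<Longrightarrow>
      \<bar>p (x * exp (- z)) - p (x * exp (- z'))\<bar> \<le> L * \<bar>z - z'\<bar>"
    "\<And>x z z'. x \<in> {0..R0} \<Longrightarrow> \<bar>z\<bar> \<le> B \<Longrightarrow> \<bar>z'\<bar> \<le> B \<Longrightarrow>
      \<bar>p (x * exp (- z)) * exp z - p (x * exp (- z')) * exp z'\<bar> \<le> L * \<bar>z - z'\<bar>"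
    "\<And>x z. x \<in> {0..R0} \<Longrightarrow> \<bar>z\<bar> \<le> B \<Longrightarrow> \<bar>p (x * exp (- z))\<bar> \<le> L"
    "\<And>x z. x \<in> {0..R0} \<Longrightarrow> \<bar>z\<bar> \<le> B \<Longrightarrow> \<bar>p (x * exp (- z)) * exp z\<bar> \<le> L"
    using pressure_exp_lipschitz[of B] by blast
  define m where "m t = (\<integral>y. p (\<rho> y * exp (- apply_bcontfun (v t) (\<rho> y))) * exp (apply_bcontfun (v t) (\<rho> y)) \<partial>torus_measure)" for t
  have mc: "continuous_on UNIV m" unfolding m_def by (rule mean_flow_continuous[OF vc vB])
  have "bounded (m ` {0..T})"
    by (intro compact_imp_bounded compact_continuous_image continuous_on_subset[OF mc]) auto
  then obtain A where "\<forall>x\<in>m ` {0..T}. norm x \<le> A" unfolding bounded_iff by blast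
  then have A: "\<And>t. t \<in> {0..T} \<Longrightarrow> \<bar>m t\<bar> \<le> A" by simp
  define \<eta> where "\<eta> t y = \<rho> y * exp (- apply_bcontfun (v t) (\<rho> y))" for t y
  define \<sigma> where "\<sigma> t y = p (\<eta> t y) - m t" for t y
  have \<eta>0: "0 \<le> \<eta> t y" for t y using \<rho>_nonneg by (simp add: \<eta>_def)
  have \<eta>b: "\<eta> t y \<le> R0 * exp B" for t y
    unfolding \<eta>_def using \<rho>_nonneg[of y] \<rho>_le[of y] vb[of t "\<rho> y"] by (intro mult_mono) auto
  have \<sigma>b: "\<bar>\<sigma> t y\<bar> \<le> L + A" if "t \<in> {0..T}" for t y
    using L(4)[OF \<rho>_range[of y] vb[of t "\<rho> y"]] A[OF that] unfolding \<sigma>_def \<eta>_def by linarith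
  have dv: "((\<lambda>t. apply_bcontfun (v t) (\<rho> y)) has_real_derivative \<sigma> s y) (at s within {0..t})"
    if "s \<in> {0..t}" "t \<in> {0..T}" for s t y
  proof -
    have s: "s \<in> {0..T}" using that by auto
    have "((\<lambda>t. apply_bcontfun (u t) (\<rho> y)) has_real_derivative \<sigma> s y) (at s within {0..t})"
      using DERIV_subset[OF der[OF s \<rho>_range[of y]], of "{0..t}"] that unfolding \<sigma>_def \<eta>_def m_def vu[OF s] by auto
    then show ?thesis
      by (rule has_field_derivative_transform_within[OF _ zero_less_one that(1)]) (use vu that in auto)
  qed
  have v0: "v 0 = 0" using vu[of 0] T u0 by simp
  have I\<sigma>: "(LINT s:{0..t}|lebesgue. \<sigma> s y) = apply_bcontfun (v t) (\<rho> y)" if "t \<in> {0..T}" for t y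
    using LINT_derivative[of t "\<lambda>t. apply_bcontfun (v t) (\<rho> y)" "\<lambda>s. \<sigma> s y" "L + A"] dv \<sigma>b that
    by (simp add: v0)
  have I\<eta>: "\<eta> t y = \<rho> y - (LINT s:{0..t}|lebesgue. \<eta> s y * \<sigma> s y)" if t: "t \<in> {0..T}" for t y
  proof -
    have "(LINT s:{0..t}|lebesgue. \<eta> s y * \<sigma> s y) = (- \<eta> t y) - (- \<eta> 0 y)"
    proof (rule LINT_derivative[of t "\<lambda>s. - \<eta> s y" _ "(R0 * exp B) * (L + A)"])
      fix s assume s: "s \<in> {0..t}"
      show "((\<lambda>s. - \<eta> s y) has_real_derivative \<eta> s y * \<sigma> s y) (at s within {0..t})"
        using dv[OF s t, of y] unfolding \<eta>_def by (auto intro!: derivative_eq_intros)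
      show "\<bar>\<eta> s y * \<sigma> s y\<bar> \<le> R0 * exp B * (L + A)"
        unfolding abs_mult using \<eta>0[of s y] \<eta>b[of s y] \<sigma>b[of s y] s t R0_nonneg by (intro mult_mono) auto
    qed (use t in auto)
    then show ?thesis by (simp add: \<eta>_def v0)
  qed
  have vm: "(\<lambda>z. apply_bcontfun (v (fst z)) (\<rho> (snd z))) \<in> borel_measurable borel"
  proof -
    have 1: "(\<lambda>z. apply_bcontfun (v (fst z)) (snd z)) \<in> borel_measurable borel"
      by (intro borel_measurable_continuous_onI continuous_on_bcontfun_eval vc)
    have 2: "(\<lambda>z :: real \<times> (real^'d). (fst z, \<rho> (snd z))) \<in> borel \<rightarrow>\<^sub>M borel"
      unfolding borel_prod[symmetric] using \<rho>(1) by measurable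
    show ?thesis using measurable_compose[OF 2 1] by simp
  qed
  have sndm: "(\<lambda>z :: real \<times> (real^'d). \<rho> (snd z)) \<in> borel_measurable borel"
    unfolding borel_prod[symmetric] using \<rho>(1) by measurable
  have fstm: "(\<lambda>z :: real \<times> (real^'d). m (fst z)) \<in> borel_measurable borel"
    unfolding borel_prod[symmetric] using borel_measurable_continuous_onI[OF mc] by measurable
  have \<eta>m: "(\<lambda>(t, y). \<eta> t y) \<in> borel_measurable borel"
    unfolding \<eta>_def case_prod_beta using vm sndm by measurable
  have p\<eta>m: "(\<lambda>z. p (\<eta> (fst z) (snd z))) \<in> borel_measurable borel"
    using \<eta>m[unfolded case_prod_beta] by (intro continuous_nonneg_comp_measurable[OF p_cont]) (auto simp: \<eta>0)
  have \<sigma>m: "(\<lambda>(t, y). \<sigma> t y) \<in> borel_measurable borel"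
    unfolding \<sigma>_def case_prod_beta using p\<eta>m fstm by measurable
  have avg: "avg_sigma \<sigma> (\<lambda>t y. p (\<eta> t y)) t = m t" if t: "t \<in> {0..T}" for t
  proof -
    have [measurable]: "apply_bcontfun (v t) \<in> borel_measurable borel"
      by (intro borel_measurable_continuous_onI continuous_on_apply_bcontfun)
    have "(\<lambda>y. p (\<rho> y * exp (- apply_bcontfun (v t) (\<rho> y))) * exp (apply_bcontfun (v t) (\<rho> y))) \<in> borel_measurable borel"
      using \<rho>(1) \<rho>_nonneg
      by (intro borel_measurable_times continuous_nonneg_comp_measurable[OF p_cont]) auto
    then show ?thesis
      unfolding avg_sigma_def measure_torus I\<sigma>[OF t] unfolding m_def \<eta>_def
      by (subst LINT_torus) auto
  qed
  have Q: "{0..T} \<times> torus \<in> sets (borel :: (real \<times> (real^'d)) measure)"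
    unfolding borel_prod[symmetric] by measurable
  have "solves_L p rho0 T \<eta> \<sigma>"
    unfolding solves_L_def
  proof (intro conjI)
    show "Linfty_on ({0..T} \<times> torus) (\<lambda>(t, y). \<eta> t y)"
      by (rule Linfty_on_if_borel[OF \<eta>m Q, of "R0 * exp B"]) (use \<eta>0 \<eta>b in auto)
    show "Linfty_on ({0..T} \<times> torus) (\<lambda>(t, y). \<sigma> t y)"
      by (rule Linfty_on_if_borel[OF \<sigma>m Q, of "L + A"]) (use \<sigma>b in auto)
    have "AE z in (lborel :: (real \<times> (real^'d)) measure). snd z \<in> torus \<longrightarrow> rho0 (snd z) = \<rho> (snd z)"
      by (rule AE_lborel_fst_snd(2)[OF \<rho>(2)])
    then show "AE z in lebesgue. z \<in> {0..T} \<times> torus \<longrightarrow>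
        \<eta> (fst z) (snd z) = rho0 (snd z) - (LINT s:{0..fst z}|lebesgue. \<eta> s (snd z) * \<sigma> s (snd z)) \<and>
        \<sigma> (fst z) (snd z) = p (\<eta> (fst z) (snd z)) - avg_sigma \<sigma> (\<lambda>t y. p (\<eta> t y)) (fst z)"
      unfolding AE_completion_iff
    proof eventually_elim
      case (elim z)
      then show ?case using I\<eta>[of "fst z" "snd z"] avg[of "fst z"] by (auto simp: \<sigma>_def)
    qed
  qed
  then show ?thesis by (rule that) (simp add: \<eta>_def vu)
qed

text \<open>The displacement is the time integral of an everywhere bounded Borel representative of
  \<sigma>, not of \<sigma> itself. It is therefore measurable and Lipschitz in time for every y,
  and null sets remain only in the equations.\<close>

lemma solves_L_regularity:
  fixes \<rho> rho0 :: "real^'d \<Rightarrow> real"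
  assumes flow: "lagrangian_flow torus_measure \<rho> R0 p D"
    and \<rho>: "\<rho> \<in> borel_measurable borel" "AE y in lborel. y \<in> torus \<longrightarrow> rho0 y = \<rho> y"
    and T: "0 < T" and sol: "solves_L p rho0 T \<eta> \<sigma>"
  obtains U :: "real \<Rightarrow> real^'d \<Rightarrow> real" and B where
    "\<And>t. t \<in> {0..T} \<Longrightarrow> U t \<in> borel_measurable torus_measure"
    "\<And>t y. t \<in> {0..T} \<Longrightarrow> \<bar>U t y\<bar> \<le> B"
    "\<And>s t y. s \<in> {0..T} \<Longrightarrow> t \<in> {0..T} \<Longrightarrow> \<bar>U t y - U s y\<bar> \<le> B * \<bar>t - s\<bar>"
    "AE y in torus_measure. \<forall>t\<in>{0..T}. U t y = integral {0..t} (\<lambda>s. p (\<rho> y * exp (- U s y))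
       - (\<integral>y. p (\<rho> y * exp (- U s y)) * exp (U s y) \<partial>torus_measure))"
    "AE z in lborel. z \<in> {0..T} \<times> torus \<longrightarrow> \<eta> (fst z) (snd z) = \<rho> (snd z) * exp (- U (fst z) (snd z)) \<and>
       \<sigma> (fst z) (snd z) = p (\<rho> (snd z) * exp (- U (fst z) (snd z)))
         - (\<integral>y. p (\<rho> y * exp (- U (fst z) y)) * exp (U (fst z) y) \<partial>torus_measure)"
proof -
  interpret lagrangian_flow torus_measure \<rho> R0 p D by (rule flow)
  note [measurable] = \<rho>(1)
  let ?Q = "{0..T} \<times> torus :: (real \<times> (real^'d)) set"
  obtain h Bh where h: "h \<in> borel_measurable borel" "\<And>z. \<bar>h z\<bar> \<le> Bh"
    "AE z in lborel. z \<in> ?Q \<longrightarrow> \<eta> (fst z) (snd z) = h z"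
  proof -
    have "Linfty_on ?Q (\<lambda>z. \<eta> (fst z) (snd z))" using sol by (simp only: solves_L_def case_prod_beta')
    from Linfty_on_borel_representative[OF this] that show thesis by blast
  qed
  obtain g Bg where g: "g \<in> borel_measurable borel" "\<And>z. \<bar>g z\<bar> \<le> Bg"
    "AE z in lborel. z \<in> ?Q \<longrightarrow> \<sigma> (fst z) (snd z) = g z"
  proof -
    have "Linfty_on ?Q (\<lambda>z. \<sigma> (fst z) (snd z))" using sol by (simp only: solves_L_def case_prod_beta')
    from Linfty_on_borel_representative[OF this] that show thesis by blast
  qed
  have Bg: "0 \<le> Bg" and Bh: "0 \<le> Bh" using g(2)[of undefined] h(2)[of undefined] by auto
  have hgb: "\<bar>h z * g z\<bar> \<le> Bh * Bg" for z
    unfolding abs_mult using g(2) h(2) Bh by (intro mult_mono) auto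
  have eqs: "AE z in lborel. z \<in> ?Q \<longrightarrow>
        (\<eta> (fst z) (snd z) = rho0 (snd z) - (LINT s:{0..fst z}|lebesgue. \<eta> s (snd z) * \<sigma> s (snd z)) \<and>
         \<sigma> (fst z) (snd z) = p (\<eta> (fst z) (snd z)) - avg_sigma \<sigma> (\<lambda>t y. p (\<eta> t y)) (fst z))"
    using sol unfolding solves_L_def AE_completion_iff by blast
  have sec: "(\<lambda>s. f (s, y)) \<in> borel_measurable borel" if "f \<in> borel_measurable borel"
    for f :: "real \<times> (real^'d) \<Rightarrow> real" and y
    by (rule measurable_compose[OF _ that]) (auto intro!: borel_measurable_continuous_onI continuous_intros)
  have gi: "(\<lambda>s. g (s, y)) integrable_on {a..b}" for y a b
    by (rule LINT_bounded_borel(1)[OF sec[OF g(1)] g(2)])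
  have hgm: "(\<lambda>z. h z * g z) \<in> borel_measurable borel" using h(1) g(1) by measurable
  have hgi: "(\<lambda>s. h (s, y) * g (s, y)) integrable_on {a..b}" for y a b
    by (rule LINT_bounded_borel(1)[OF sec[OF hgm] hgb])
  define U where "U t y = integral {0..t} (\<lambda>s. g (s, y))" for t y
  have Ul0: "\<bar>U t y - U s y\<bar> \<le> Bg * (t - s)" if "0 \<le> s" "s \<le> t" for s t y
    using integral_diff_initial[OF gi, of s t t y] abs_integral_le_const[OF gi that(2), of y Bg] that g(2)
    unfolding U_def by simp
  have Ul: "\<bar>U t y - U s y\<bar> \<le> Bg * \<bar>t - s\<bar>" if "s \<in> {0..T}" "t \<in> {0..T}" for s t y
    using Ul0[of s t y] Ul0[of t s y] that by (cases "s \<le> t") (auto simp: abs_minus_commute)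
  have Ub: "\<bar>U t y\<bar> \<le> Bg * T" if "t \<in> {0..T}" for t y
  proof -
    have "\<bar>U t y\<bar> \<le> Bg * t" using Ul0[of 0 t y] that by (simp add: U_def)
    also have "\<dots> \<le> Bg * T" using that Bg by (intro mult_left_mono) auto
    finally show ?thesis .
  qed
  have Um: "(\<lambda>z. U (fst z) (snd z)) \<in> borel_measurable borel"
  proof -
    have sets_eq: "sets ((borel :: (real \<times> (real^'d)) measure) \<Otimes>\<^sub>M lborel) = sets (borel :: ((real \<times> (real^'d)) \<times> real) measure)"
      unfolding borel_prod[symmetric] by (intro sets_pair_measure_cong) auto
    have g': "(\<lambda>z :: (real \<times> (real^'d)) \<times> real. g (snd z, snd (fst z))) \<in> borel_measurable (borel \<Otimes>\<^sub>M lborel)"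
      by (rule measurable_compose[OF _ g(1)])
         (unfold measurable_cong_sets[OF sets_eq refl], intro borel_measurable_continuous_onI continuous_intros)
    \<comment> \<open>Moving the variable upper limit into the integrand gives an integral over a
      fixed space, to which measurability of parameter integrals applies.\<close>
    have "U (fst z) (snd z) = (\<integral>s. (if 0 \<le> s \<and> s \<le> fst z then g (s, snd z) else 0) \<partial>lborel)" for z
    proof -
      have "U (fst z) (snd z) = (LINT s:{0..fst z}|lebesgue. g (s, snd z))"
        unfolding U_def by (rule LINT_bounded_borel(2)[OF sec[OF g(1)] g(2), symmetric]) simp
      also have "\<dots> = (\<integral>s. indicator {0..fst z} s *\<^sub>R g (s, snd z) \<partial>lborel)"
        unfolding set_lebesgue_integral_def
        by (rule integral_completion) (use sec[OF g(1), of "snd z"] in measurable)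
      also have "\<dots> = (\<integral>s. (if 0 \<le> s \<and> s \<le> fst z then g (s, snd z) else 0) \<partial>lborel)"
        by (intro Bochner_Integration.integral_cong) (auto simp: indicator_def)
      finally show ?thesis .
    qed
    moreover have "(\<lambda>z. \<integral>s. (if 0 \<le> s \<and> s \<le> fst z then g (s, snd z) else 0) \<partial>lborel) \<in> borel_measurable (borel :: (real \<times> (real^'d)) measure)"
    proof (rule lborel.borel_measurable_lebesgue_integral)
      have [measurable]: "(\<lambda>z :: (real \<times> (real^'d)) \<times> real. fst (fst z)) \<in> borel_measurable (borel \<Otimes>\<^sub>M lborel)"
        unfolding measurable_cong_sets[OF sets_eq refl]
        by (intro borel_measurable_continuous_onI continuous_intros)
      show "(\<lambda>(z, s). if 0 \<le> s \<and> s \<le> fst z then g (s, snd z) else 0) \<in> borel_measurable ((borel :: (real \<times> (real^'d)) measure) \<Otimes>\<^sub>M lborel)"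
        unfolding case_prod_beta using g' by measurable
    qed
    ultimately show ?thesis by simp
  qed
  have Uy: "U t \<in> borel_measurable borel" for t
    using measurable_compose[OF _ Um, of "\<lambda>y. (t, y)" borel]
    by (auto intro!: borel_measurable_continuous_onI continuous_intros)
  define G where "G t y = p (\<rho> y * exp (- U t y)) * exp (U t y)" for t y
  define A where "A t = (\<integral>y. G t y \<partial>torus_measure)" for t
  have Gm: "G t \<in> borel_measurable borel" for t
    unfolding G_def using Uy[of t] \<rho>_nonneg
    by (intro borel_measurable_times continuous_nonneg_comp_measurable[OF p_cont]) auto

  have good: "AE y in lborel. y \<in> torus \<longrightarrow>
      (\<forall>t\<in>{0..T}. (LINT s:{0..t}|lebesgue. \<sigma> s y) = U t y) \<and>
      (AE t in lborel. t \<in> {0..T} \<longrightarrow> h (t, y) = \<rho> y * exp (- U t y))"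
    using \<rho>(2) AE_lborel_pairD(2)[OF h(3)] AE_lborel_pairD(2)[OF g(3)] AE_lborel_pairD(2)[OF eqs]
  proof eventually_elim
    case (elim y)
    show ?case
    proof (intro impI conjI ballI)
      assume y: "y \<in> torus"
      fix t assume t: "t \<in> {0..T}"
      show "(LINT s:{0..t}|lebesgue. \<sigma> s y) = U t y"
        unfolding U_def by (rule LINT_bounded_borel(2)[OF sec[OF g(1)] g(2)])
          (use elim(3) in eventually_elim, use t y in auto)
    next
      assume y: "y \<in> torus"
      \<comment> \<open>For fixed y the representative h satisfies its equation only at almost every
        t. The right-hand side N is defined for all t, and exchanging h for N under the integral
        does no harm, so N satisfies the linear integral equation at every t.\<close>
      define N where "N t = \<rho> y - integral {0..t} (\<lambda>s. h (s, y) * g (s, y))" for t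
      have I: "(LINT s:{0..t}|lebesgue. \<eta> s y * \<sigma> s y) = integral {0..t} (\<lambda>s. h (s, y) * g (s, y))" if t: "t \<in> {0..T}" for t
        by (rule LINT_bounded_borel(2)[OF sec[OF hgm] hgb])
          (use elim(2,3) in eventually_elim, use t y in auto)
      have hN: "AE t in lborel. t \<in> {0..T} \<longrightarrow> h (t, y) = N t"
        using elim(2,4) by eventually_elim (use y I elim(1) in \<open>auto simp: N_def\<close>)
      have sp: "((\<lambda>s. N s * g (s, y)) has_integral k) {0..t} \<longleftrightarrow> ((\<lambda>s. h (s, y) * g (s, y)) has_integral k) {0..t}"
        if "t \<le> T" for t k
        by (rule has_integral_AE) (use hN in eventually_elim, use that in auto)
      have "N t = \<rho> y * exp (- U t y)" if "t \<in> {0..T}" for t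
        unfolding U_def
      proof (rule linear_integral_equation_exp[OF gi g(2) _ _ that])
        show "(\<lambda>s. N s * g (s, y)) integrable_on {0..T}"
          using hgi[of y 0 T] sp[of T] unfolding integrable_on_def by auto
        fix t assume "t \<in> {0..T}"
        then show "N t = \<rho> y - integral {0..t} (\<lambda>s. N s * g (s, y))"
          using sp[of t] integrable_integral[OF hgi[of y 0 t]] unfolding N_def
          by (metis (no_types, lifting) atLeastAtMost_iff integral_unique)
      qed
      then show "AE t in lborel. t \<in> {0..T} \<longrightarrow> h (t, y) = \<rho> y * exp (- U t y)"
        using hN by (auto elim!: eventually_mono)
    qed
  qed
  have hU: "AE z in lborel. z \<in> ?Q \<longrightarrow> h z = \<rho> (snd z) * exp (- U (fst z) (snd z))"
  proof (rule AE_lborel_pairI)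
    have [measurable]: "(\<lambda>z :: real \<times> (real^'d). \<rho> (snd z)) \<in> borel_measurable borel"
      unfolding borel_prod[symmetric] by measurable
    have [measurable]: "?Q \<in> sets borel" unfolding borel_prod[symmetric] by measurable
    note [measurable] = h(1) Um
    have "{z \<in> space borel. z \<in> ?Q \<longrightarrow> h z = \<rho> (snd z) * exp (- U (fst z) (snd z))} \<in> sets borel"
      by measurable
    then show "{z. z \<in> ?Q \<longrightarrow> h z = \<rho> (snd z) * exp (- U (fst z) (snd z))} \<in> sets borel" by simp
    show "AE y in lborel. AE x in lborel. (x, y) \<in> ?Q \<longrightarrow> h (x, y) = \<rho> (snd (x, y)) * exp (- U (fst (x, y)) (snd (x, y)))"
      using good by eventually_elim (auto elim!: eventually_mono)
  qed
  have \<eta>U: "AE z in lborel. z \<in> ?Q \<longrightarrow> \<eta> (fst z) (snd z) = \<rho> (snd z) * exp (- U (fst z) (snd z))"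
    using hU h(3) by eventually_elim auto
  \<comment> \<open>Here the sections are taken at fixed t, while \<open>good\<close> uses fixed y.
    They combine because the null set of y in \<open>good\<close>, outside which the inner time
    integral of \<sigma> equals U, is the same for all t.\<close>
  have avg: "AE t in lborel. t \<in> {0..T} \<longrightarrow> avg_sigma \<sigma> (\<lambda>t y. p (\<eta> t y)) t = A t"
    using AE_lborel_pairD(1)[OF \<eta>U]
  proof eventually_elim
    case (elim t)
    show ?case
    proof
      assume t: "t \<in> {0..T}"
      have "AE y in lborel. y \<in> torus \<longrightarrow> p (\<eta> t y) * exp (LINT s:{0..t}|lebesgue. \<sigma> s y) = G t y"
        using elim good by eventually_elim (use t in \<open>auto simp: G_def\<close>)
      then show "avg_sigma \<sigma> (\<lambda>t y. p (\<eta> t y)) t = A t"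
        unfolding avg_sigma_def measure_torus A_def by (subst LINT_torus[OF Gm]) auto
    qed
  qed
  have \<sigma>U: "AE z in lborel. z \<in> ?Q \<longrightarrow> \<sigma> (fst z) (snd z) = p (\<rho> (snd z) * exp (- U (fst z) (snd z))) - A (fst z)"
    using \<eta>U eqs AE_lborel_fst_snd(1)[OF avg] by eventually_elim auto
  have gU: "AE z in lborel. z \<in> ?Q \<longrightarrow> g z = p (\<rho> (snd z) * exp (- U (fst z) (snd z))) - A (fst z)"
    using \<sigma>U g(3) by eventually_elim auto
  \<comment> \<open>Under the time integral g may be replaced by the expression it equals for almost
    every time, which promotes the equation for U to every t.\<close>
  have UI: "AE y in lborel. y \<in> torus \<longrightarrow> (\<forall>t\<in>{0..T}. U t y = integral {0..t} (\<lambda>s. p (\<rho> y * exp (- U s y)) - A s))"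
    using AE_lborel_pairD(2)[OF gU]
  proof eventually_elim
    case (elim y)
    show ?case
    proof (intro impI ballI)
      fix t assume y: "y \<in> torus" and t: "t \<in> {0..T}"
      have "((\<lambda>s. g (s, y)) has_integral U t y) {0..t}"
        unfolding U_def by (rule integrable_integral[OF gi])
      then have "((\<lambda>s. p (\<rho> y * exp (- U s y)) - A s) has_integral U t y) {0..t}"
        by (rule has_integral_AE[THEN iffD1, rotated]) (use elim in eventually_elim, use t y in auto)
      then show "U t y = integral {0..t} (\<lambda>s. p (\<rho> y * exp (- U s y)) - A s)"
        by (simp add: integral_unique)
    qed
  qed
  show ?thesis
  \<comment> \<open>One constant covers both the Lipschitz bound Bg and the supremum bound Bg
    T.\<close>
  proof (rule that[of U "Bg + Bg * T"])
    show "U t \<in> borel_measurable torus_measure" for t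
      by (rule borel_measurable_torus_measure[OF Uy])
    show "\<bar>U t y\<bar> \<le> Bg + Bg * T" if "t \<in> {0..T}" for t y using Ub[OF that, of y] Bg by simp
    show "\<bar>U t y - U s y\<bar> \<le> (Bg + Bg * T) * \<bar>t - s\<bar>" if "s \<in> {0..T}" "t \<in> {0..T}" for s t y
      using Ul[OF that, of y] mult_right_mono[of Bg "Bg + Bg * T" "\<bar>t - s\<bar>"] Bg T by simp
    show "AE y in torus_measure. \<forall>t\<in>{0..T}. U t y = integral {0..t} (\<lambda>s. p (\<rho> y * exp (- U s y))
       - (\<integral>y. p (\<rho> y * exp (- U s y)) * exp (U s y) \<partial>torus_measure))"
      using UI unfolding AE_torus_measure_iff A_def G_def .
    show "AE z in lborel. z \<in> {0..T} \<times> torus \<longrightarrow> \<eta> (fst z) (snd z) = \<rho> (snd z) * exp (- U (fst z) (snd z)) \<and>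
       \<sigma> (fst z) (snd z) = p (\<rho> (snd z) * exp (- U (fst z) (snd z)))
         - (\<integral>y. p (\<rho> y * exp (- U (fst z) y)) * exp (U (fst z) y) \<partial>torus_measure)"
      using \<eta>U \<sigma>U unfolding A_def G_def by eventually_elim auto
  qed
qed

text \<open>The null set of y on which the displacements differ is independent of t. Hence the means
  agree at every t, and \<eta> and \<sigma> are determined by displacement and mean almost
  everywhere.\<close>

lemma solves_L_unique:
  fixes \<rho> rho0 :: "real^'d \<Rightarrow> real"
  assumes flow: "lagrangian_flow torus_measure \<rho> R0 p D"
    and \<rho>: "\<rho> \<in> borel_measurable borel" "AE y in lborel. y \<in> torus \<longrightarrow> rho0 y = \<rho> y"
    and T: "0 < T" and sol: "solves_L p rho0 T \<eta> \<sigma>" "solves_L p rho0 T \<eta>' \<sigma>'"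
  shows "AE z in lebesgue. z \<in> {0..T} \<times> torus \<longrightarrow>
    \<eta> (fst z) (snd z) = \<eta>' (fst z) (snd z) \<and> \<sigma> (fst z) (snd z) = \<sigma>' (fst z) (snd z)"
proof -
  interpret lagrangian_flow torus_measure \<rho> R0 p D by (rule flow)
  let ?m = "\<lambda>W s. \<integral>y. p (\<rho> y * exp (- W s y)) * exp (W s y) \<partial>torus_measure"
  obtain U B where U: "\<And>t. t \<in> {0..T} \<Longrightarrow> U t \<in> borel_measurable torus_measure"
    "\<And>t y. t \<in> {0..T} \<Longrightarrow> \<bar>U t y\<bar> \<le> B"
    "\<And>s t y. s \<in> {0..T} \<Longrightarrow> t \<in> {0..T} \<Longrightarrow> \<bar>U t y - U s y\<bar> \<le> B * \<bar>t - s\<bar>"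
    "AE y in torus_measure. \<forall>t\<in>{0..T}. U t y = integral {0..t} (\<lambda>s. p (\<rho> y * exp (- U s y)) - ?m U s)"
    "AE z in lborel. z \<in> {0..T} \<times> torus \<longrightarrow> \<eta> (fst z) (snd z) = \<rho> (snd z) * exp (- U (fst z) (snd z)) \<and>
       \<sigma> (fst z) (snd z) = p (\<rho> (snd z) * exp (- U (fst z) (snd z))) - ?m U (fst z)"
    using solves_L_regularity[OF flow \<rho> T sol(1)] by blast
  obtain V B' where V: "\<And>t. t \<in> {0..T} \<Longrightarrow> V t \<in> borel_measurable torus_measure"
    "\<And>t y. t \<in> {0..T} \<Longrightarrow> \<bar>V t y\<bar> \<le> B'"
    "\<And>s t y. s \<in> {0..T} \<Longrightarrow> t \<in> {0..T} \<Longrightarrow> \<bar>V t y - V s y\<bar> \<le> B' * \<bar>t - s\<bar>"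
    "AE y in torus_measure. \<forall>t\<in>{0..T}. V t y = integral {0..t} (\<lambda>s. p (\<rho> y * exp (- V s y)) - ?m V s)"
    "AE z in lborel. z \<in> {0..T} \<times> torus \<longrightarrow> \<eta>' (fst z) (snd z) = \<rho> (snd z) * exp (- V (fst z) (snd z)) \<and>
       \<sigma>' (fst z) (snd z) = p (\<rho> (snd z) * exp (- V (fst z) (snd z))) - ?m V (fst z)"
    using solves_L_regularity[OF flow \<rho> T sol(2)] by blast
  have UV: "AE y in torus_measure. \<forall>t\<in>{0..T}. U t y = V t y"
  proof (rule flow_unique[where B="max B B'"])
    fix W assume W: "W \<in> {U, V}"
    then show "W t \<in> borel_measurable torus_measure" if "t \<in> {0..T}" for t
      using U(1)[OF that] V(1)[OF that] by blast
    show "\<bar>W t y\<bar> \<le> max B B'" if "t \<in> {0..T}" for t y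
      using W U(2)[OF that, of y] V(2)[OF that, of y] by auto
    show "\<bar>W t y - W s y\<bar> \<le> max B B' * \<bar>t - s\<bar>" if "s \<in> {0..T}" "t \<in> {0..T}" for s t y
      using W U(3)[OF that, of y] V(3)[OF that, of y] mult_right_mono[of B "max B B'" "\<bar>t - s\<bar>"]
        mult_right_mono[of B' "max B B'" "\<bar>t - s\<bar>"] by auto
    show "AE y in torus_measure. \<forall>t\<in>{0..T}. W t y = integral {0..t} (\<lambda>s. p (\<rho> y * exp (- W s y)) - ?m W s)"
      using W U(4) V(4) by auto
  qed
  have m: "?m U t = ?m V t" if t: "t \<in> {0..T}" for t
  proof (rule integral_cong_AE)
    show "(\<lambda>y. p (\<rho> y * exp (- U t y)) * exp (U t y)) \<in> borel_measurable torus_measure"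
      "(\<lambda>y. p (\<rho> y * exp (- V t y)) * exp (V t y)) \<in> borel_measurable torus_measure"
      using U(1)[OF t] V(1)[OF t] \<rho>_nonneg
      by (auto intro!: borel_measurable_times continuous_nonneg_comp_measurable[OF p_cont])
    show "AE y in torus_measure. p (\<rho> y * exp (- U t y)) * exp (U t y) = p (\<rho> y * exp (- V t y)) * exp (V t y)"
      using UV by eventually_elim (use t in auto)
  qed
  have "AE z in (lborel :: (real \<times> (real^'d)) measure). snd z \<in> torus \<longrightarrow> (\<forall>t\<in>{0..T}. U t (snd z) = V t (snd z))"
    using UV unfolding AE_torus_measure_iff by (rule AE_lborel_fst_snd(2))
  then show ?thesis
    unfolding AE_completion_iff using U(5) V(5)
    by eventually_elim (auto simp: m)
qed

section \<open>The pressure potential\<close>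

lemma Pfun_derivative:
  assumes p: "continuous_on {0..} p" and rb: "0 < rhobar" and x: "0 < x"
  shows "((\<lambda>x. interval_lebesgue_integral lborel (ereal rhobar) (ereal x) (\<lambda>s. p s / s^2))
      has_real_derivative p x / x^2) (at x)"
    and "(Pfun p rhobar C1 C2 has_real_derivative (p x + Pfun p rhobar C1 C2 x - C2) / x) (at x)"
proof -
  let ?I = "\<lambda>x. interval_lebesgue_integral lborel (ereal rhobar) (ereal x) (\<lambda>s. p s / s^2)"
  \<comment> \<open>A compact interval inside the positive half-line that contains
    \<open>rhobar\<close> and has x in its interior; the singular factor 1/s^2 is continuous
    there.\<close>
  define a b where "a = min x rhobar / 2" and "b = max x rhobar + 1"
  have ab: "0 < a" "a < x" "a \<le> rhobar" "x < b" "rhobar \<le> b" using rb x by (auto simp: a_def b_def)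
  have "continuous_on {a..b} (\<lambda>s. p s / s^2)"
    using ab by (intro continuous_intros continuous_on_subset[OF p]) auto
  then have "(?I has_vector_derivative p x / x^2) (at x within {a..b})"
    using ab by (intro interval_integral_FTC2) auto
  moreover have "at x within {a..b} = at x" using ab by (intro at_within_interior) auto
  ultimately show I: "(?I has_real_derivative p x / x^2) (at x)"
    by (simp add: has_real_derivative_iff_has_vector_derivative)
  have "((\<lambda>x. x * ?I x + C1 * x + C2) has_real_derivative (?I x + x * (p x / x^2) + C1)) (at x)"
    using I by (auto intro!: derivative_eq_intros)
  moreover have "?I x + x * (p x / x^2) + C1 = (p x + Pfun p rhobar C1 C2 x - C2) / x"
    unfolding Pfun_def using x by (simp add: field_simps power2_eq_square)
  ultimately show "(Pfun p rhobar C1 C2 has_real_derivative (p x + Pfun p rhobar C1 C2 x - C2) / x) (at x)"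
    unfolding Pfun_def[abs_def] by simp
qed

text \<open>Write x I(x) as I(x) / (1/x) and apply l'Hopital's rule in the form where only the
  denominator must tend to infinity: the quotient of derivatives is -p(x). The integral itself may
  diverge at 0.\<close>

lemma Pfun_tendsto_0:
  assumes p: "continuous_on {0..} p" and rb: "0 < rhobar"
  shows "(Pfun p rhobar C1 C2 \<longlongrightarrow> C2 - p 0) (at_right 0)"
proof -
  let ?I = "\<lambda>x. interval_lebesgue_integral lborel (ereal rhobar) (ereal x) (\<lambda>s. p s / s^2)"
  have ev: "eventually (\<lambda>x::real. 0 < x) (at_right 0)" by (simp add: eventually_at_right_less)
  have p0: "(p \<longlongrightarrow> p 0) (at_right 0)"
    using p by (simp add: continuous_on_def at_within_Ici_at_right[symmetric])
  have "((\<lambda>x. ?I x / inverse x) \<longlongrightarrow> - p 0) (at_right 0)"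
  proof (rule lhopital_right_0_at_top[where f'="\<lambda>x. p x / x^2" and g'="\<lambda>x. - inverse (x^2)"])
    show "LIM x at_right 0. inverse x :> (at_top :: real filter)" by (rule filterlim_inverse_at_top_right)
    show "eventually (\<lambda>x. - inverse (x\<^sup>2) \<noteq> (0::real)) (at_right 0)" using ev by eventually_elim auto
    show "eventually (\<lambda>x. (?I has_real_derivative p x / x\<^sup>2) (at x)) (at_right 0)"
      using ev by eventually_elim (rule Pfun_derivative(1)[OF p rb])
    show "eventually (\<lambda>x::real. (inverse has_real_derivative - inverse (x\<^sup>2)) (at x)) (at_right 0)"
      using ev by eventually_elim (auto intro!: derivative_eq_intros simp: power2_eq_square)
    have "((\<lambda>x. - p x) \<longlongrightarrow> - p 0) (at_right 0)" by (intro tendsto_intros p0)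
    then show "((\<lambda>x. p x / x\<^sup>2 / - inverse (x\<^sup>2)) \<longlongrightarrow> - p 0) (at_right 0)"
      by (rule Lim_transform_eventually) (use ev in eventually_elim, simp add: field_simps)
  qed
  moreover have "((\<lambda>x. C1 * x) \<longlongrightarrow> C1 * 0) (at_right 0)" by (intro tendsto_intros)
  ultimately have "((\<lambda>x. ?I x / inverse x + C1 * x + C2) \<longlongrightarrow> - p 0 + C1 * 0 + C2) (at_right 0)"
    by (intro tendsto_intros)
  moreover have "Pfun p rhobar C1 C2 = (\<lambda>x. ?I x / inverse x + C1 * x + C2)"
    by (simp only: fun_eq_iff Pfun_def divide_inverse[of _ "inverse _"] inverse_inverse_eq mult.commute[of "interval_lebesgue_integral _ _ _ _"] simp_thms)
  ultimately show ?thesis by simp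
qed

theorem theorem2:
  fixes p :: "real \<Rightarrow> real" and rho0 :: "real^'d \<Rightarrow> real"
  assumes "Hp p"
    and "Linfty_on torus rho0"
    and "AE y in lebesgue. y \<in> torus \<longrightarrow> 0 \<le> rho0 y"
  shows "\<exists>r. \<forall>T>0.
     (\<exists>\<eta> \<sigma>. solves_L p rho0 T \<eta> \<sigma>) \<and>
     (\<forall>\<eta> \<sigma> \<eta>' \<sigma>'. solves_L p rho0 T \<eta> \<sigma> \<and> solves_L p rho0 T \<eta>' \<sigma>' \<longrightarrow>
        (AE z in lebesgue. z \<in> {0..T} \<times> torus \<longrightarrow>
           \<eta> (fst z) (snd z) = \<eta>' (fst z) (snd z) \<and> \<sigma> (fst z) (snd z) = \<sigma>' (fst z) (snd z))) \<and>
     (\<forall>\<eta> \<sigma>. solves_L p rho0 T \<eta> \<sigma> \<longrightarrow>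
        (AE z in lebesgue. z \<in> {0..T} \<times> torus \<longrightarrow> \<bar>\<eta> (fst z) (snd z)\<bar> \<le> r))"
proof -
  obtain D where D: "\<And>x. x \<ge> 0 \<Longrightarrow> (p has_real_derivative D x) (at x within {0..})" "continuous_on {0..} D"
    using assms(1) unfolding Hp_def by blast
  have unb: "\<exists>x\<ge>0. K < p x" for K using assms(1) unfolding Hp_def by blast
  obtain C C1 C2 rhobar where C: "0 < C" and rb: "0 < rhobar" and low: "\<forall>x\<ge>0. - C \<le> p x"
    and up: "\<forall>x>0. p x \<le> C * Pfun p rhobar C1 C2 x \<and> 0 \<le> Pfun p rhobar C1 C2 x"
    using assms(1) unfolding Hp_def by (elim conjE exE) (rule that)
  obtain g B where g: "g \<in> borel_measurable borel" "\<And>y. \<bar>g y\<bar> \<le> B" "AE y in lborel. y \<in> torus \<longrightarrow> rho0 y = g y"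
    using Linfty_on_borel_representative[OF assms(2)] by blast
  \<comment> \<open>Taking the positive part changes the representative only on a null subset of the
    torus, because \<open>rho0\<close> is nonnegative almost everywhere there, and gives
    nonnegativity at every y.\<close>
  define \<rho> where "\<rho> y = max 0 (g y)" for y
  have \<rho>m: "\<rho> \<in> borel_measurable borel" unfolding \<rho>_def using g(1) by measurable
  have \<rho>_ae: "AE y in lborel. y \<in> torus \<longrightarrow> rho0 y = \<rho> y"
    using g(3) assms(3)[unfolded AE_completion_iff] by eventually_elim (auto simp: \<rho>_def)
  interpret prob_space "torus_measure :: (real^'d) measure" by (rule prob_space_torus)
  have flow: "lagrangian_flow (torus_measure :: (real^'d) measure) \<rho> B p D"
  proof
    show "\<rho> \<in> borel_measurable torus_measure" by (rule borel_measurable_torus_measure[OF \<rho>m])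
    show "\<rho> y \<in> {0..B}" for y using g(2)[of y] by (auto simp: \<rho>_def)
  qed (use D in auto)
  interpret lagrangian_flow "torus_measure :: (real^'d) measure" \<rho> B p D by (rule flow)
  \<comment> \<open>At 0 the value of Pfun is C2, which differs from its limit C2 - p 0.\<close>
  define P where "P x = (if x = 0 then C2 - p 0 else Pfun p rhobar C1 C2 x)" for x
  have Pd: "(P has_real_derivative (p x + P x - C2) / x) (at x)" if "0 < x" for x
  proof -
    have "(P has_real_derivative (p x + Pfun p rhobar C1 C2 x - C2) / x) (at x)"
      by (rule has_field_derivative_transform_within[OF Pfun_derivative(2)[OF p_cont rb that] that])
         (auto simp: P_def dist_real_def)
    then show ?thesis using that by (simp add: P_def)
  qed
  have P0: "(P \<longlongrightarrow> P 0) (at_right 0)"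
  proof -
    have "(Pfun p rhobar C1 C2 \<longlongrightarrow> P 0) (at_right 0)"
      using Pfun_tendsto_0[OF p_cont rb] by (simp add: P_def)
    then show ?thesis
      by (rule Lim_transform_eventually) (auto simp: P_def eventually_at_filter)
  qed
  interpret pressure_potential "torus_measure :: (real^'d) measure" \<rho> B p D C C2 P
  proof
    show "continuous_on {0..} P"
      unfolding continuous_on_eq_continuous_within
    proof
      fix x :: real assume x: "x \<in> {0..}"
      show "continuous (at x within {0..}) P"
      proof (cases "x = 0")
        case True
        then show ?thesis using P0 by (simp add: continuous_within at_within_Ici_at_right)
      next
        case False
        then show ?thesis using x DERIV_isCont[OF Pd] by (auto intro: continuous_at_imp_continuous_within)
      qed
    qed
    show "p x \<le> C * P x" if "0 \<le> x" for x
    proof (cases "x = 0")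
      case True
      \<comment> \<open>The comparison is assumed at positive densities and passes to the limit,
        both sides being continuous at 0.\<close>
      have "p 0 \<le> C * P 0"
      proof (rule tendsto_le[of "at_right 0"])
        show "((\<lambda>x. C * P x) \<longlongrightarrow> C * P 0) (at_right 0)" by (intro tendsto_intros P0)
        show "(p \<longlongrightarrow> p 0) (at_right 0)"
          using p_cont by (simp add: continuous_on_def at_within_Ici_at_right[symmetric])
        show "eventually (\<lambda>x. p x \<le> C * P x) (at_right 0)"
          using up by (auto simp: eventually_at_filter P_def)
      qed simp
      then show ?thesis using True by simp
    next
      case False
      then show ?thesis using up that by (simp add: P_def)
    qed
  qed (use low unb Pd C in \<open>auto simp: P_def\<close>)
  obtain r where r: "\<And>T. 0 < T \<Longrightarrow> \<exists>u :: real \<Rightarrow> real \<Rightarrow>\<^sub>C real. continuous_on {0..T} u \<and> u 0 = 0 \<and>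
    (\<forall>t\<in>{0..T}. \<forall>x\<in>{0..B}. x * exp (- apply_bcontfun (u t) x) \<le> r \<and>
      ((\<lambda>t. apply_bcontfun (u t) x) has_real_derivative p (x * exp (- apply_bcontfun (u t) x))
        - (\<integral>y. p (\<rho> y * exp (- apply_bcontfun (u t) (\<rho> y))) * exp (apply_bcontfun (u t) (\<rho> y)) \<partial>torus_measure))
        (at t within {0..T}))"
    using flow_exists by blast
  show ?thesis
  proof (intro exI[of _ r] allI impI)
    fix T :: real assume T: "0 < T"
    obtain u :: "real \<Rightarrow> real \<Rightarrow>\<^sub>C real" where u: "continuous_on {0..T} u" "u 0 = 0"
      "\<forall>t\<in>{0..T}. \<forall>x\<in>{0..B}. x * exp (- apply_bcontfun (u t) x) \<le> r \<and>
      ((\<lambda>t. apply_bcontfun (u t) x) has_real_derivative p (x * exp (- apply_bcontfun (u t) x))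
        - (\<integral>y. p (\<rho> y * exp (- apply_bcontfun (u t) (\<rho> y))) * exp (apply_bcontfun (u t) (\<rho> y)) \<partial>torus_measure))
        (at t within {0..T})"
      using r[OF T] by blast
    obtain \<eta>0 \<sigma>0 where sol: "solves_L p rho0 T \<eta>0 \<sigma>0"
      and \<eta>0: "\<And>t y. t \<in> {0..T} \<Longrightarrow> \<eta>0 t y = \<rho> y * exp (- apply_bcontfun (u t) (\<rho> y))"
      using solves_L_of_flow[OF flow \<rho>m \<rho>_ae T u(1,2)] u(3) by blast
    have bound: "\<bar>\<eta>0 t y\<bar> \<le> r" if "t \<in> {0..T}" for t y
      using u(3) that \<rho>_range[of y] \<rho>_nonneg[of y] by (simp add: \<eta>0)
    note unique = solves_L_unique[OF flow \<rho>m \<rho>_ae T]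
    show "(\<exists>\<eta> \<sigma>. solves_L p rho0 T \<eta> \<sigma>) \<and>
     (\<forall>\<eta> \<sigma> \<eta>' \<sigma>'. solves_L p rho0 T \<eta> \<sigma> \<and> solves_L p rho0 T \<eta>' \<sigma>' \<longrightarrow>
        (AE z in lebesgue. z \<in> {0..T} \<times> torus \<longrightarrow>
           \<eta> (fst z) (snd z) = \<eta>' (fst z) (snd z) \<and> \<sigma> (fst z) (snd z) = \<sigma>' (fst z) (snd z))) \<and>
     (\<forall>\<eta> \<sigma>. solves_L p rho0 T \<eta> \<sigma> \<longrightarrow>
        (AE z in lebesgue. z \<in> {0..T} \<times> torus \<longrightarrow> \<bar>\<eta> (fst z) (snd z)\<bar> \<le> r))"
    proof (intro conjI allI impI)
      show "\<exists>\<eta> \<sigma>. solves_L p rho0 T \<eta> \<sigma>" using sol by blast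
      fix \<eta> \<sigma>
      show "AE z in lebesgue. z \<in> {0..T} \<times> torus \<longrightarrow> \<eta> (fst z) (snd z) = \<eta>' (fst z) (snd z) \<and> \<sigma> (fst z) (snd z) = \<sigma>' (fst z) (snd z)"
        if "solves_L p rho0 T \<eta> \<sigma> \<and> solves_L p rho0 T \<eta>' \<sigma>'" for \<eta>' \<sigma>'
        using that unique by blast
      assume "solves_L p rho0 T \<eta> \<sigma>"
      from unique[OF this sol] show "AE z in lebesgue. z \<in> {0..T} \<times> torus \<longrightarrow> \<bar>\<eta> (fst z) (snd z)\<bar> \<le> r"
        by eventually_elim (use bound in auto)
    qed
  qed
qed

end
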